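(* Let $n\ge 2$ and let $\mathbb{M}^n=(\mathbb{R}^n,\|\cdot\|)$ be a Minkowski space with unit ball $\mathbb{B}$. Every lower-dimensional convex body $K\in\mathcal{K}^n$ (i.e. every $K\in\mathcal{K}^n$ with $\dim(K)\le n-1$) fulfills $D(K)=2R(K)$ if and only if one of the following holds: (i) $n=2$ or $\mathbb{B}$ is a parallelotope, or (ii) $n=3$ and $\mathbb{B}$ is a cross-polytope.
   Context: $\mathcal{K}^n$ denotes the set of convex bodies in $\mathbb{R}^n$, i.e. non-empty, convex, compact sets (possibly with empty interior). A Minkowski space $\mathbb{M}^n=(\mathbb{R}^n,\|\cdot\|)$ is $\mathbb{R}^n$ with a norm $\|\cdot\|$; $\mathbb{B}=\{x:\|x\|\le 1\}$. For $K\in\mathcal{K}^n$, the circumradius is $R(K)=\inf\{\rho\ge 0:K\subset c+\rho\mathbb{B},\ c\in\mathbb{R}^n\}$ and the diameter is $D(K)=\max_{x,y\in K}\|x-y\|$. A parallelotope is the image of the cube $[-1,1]^n$ under a non-singular affine map; a cross-polytope is the image of $\mathrm{conv}\{\pm u^1,\dots,\pm u^n\}$ under a non-singular affine map, where $u^1,\dots,u^n$ is the canonical basis. *)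

theory Defs
  imports "HOL-Analysis.Analysis"
begin

text \<open>
  A Minkowski space is \<open>real ^ 'n\<close> together with an arbitrary norm \<open>N\<close>, passed as an explicit
  function. The type-class norm on \<open>real ^ 'n\<close> is the Euclidean one; it is used only as the source
  of the topology (for \<open>compact\<close>), which is the same for every norm in finite dimension.
\<close>

definition is_norm :: "(real ^ 'n \<Rightarrow> real) \<Rightarrow> bool" where
  "is_norm N \<longleftrightarrow>
     (\<forall>x. 0 \<le> N x) \<and>
     (\<forall>x. N x = 0 \<longleftrightarrow> x = 0) \<and>
     (\<forall>a x. N (a *\<^sub>R x) = \<bar>a\<bar> * N x) \<and>
     (\<forall>x y. N (x + y) \<le> N x + N y)"

definition unit_ball :: "(real ^ 'n \<Rightarrow> real) \<Rightarrow> (real ^ 'n) set" where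
  "unit_ball N = {x. N x \<le> 1}"

definition convex_body :: "(real ^ 'n) set \<Rightarrow> bool" where
  "convex_body K \<longleftrightarrow> K \<noteq> {} \<and> convex K \<and> compact K"

definition circumradius :: "(real ^ 'n \<Rightarrow> real) \<Rightarrow> (real ^ 'n) set \<Rightarrow> real" where
  "circumradius N K =
     Inf {\<rho>. 0 \<le> \<rho> \<and> (\<exists>c. K \<subseteq> (\<lambda>x. c + \<rho> *\<^sub>R x) ` unit_ball N)}"

text \<open>
  For a convex body the supremum is a maximum, as \<open>N\<close> is continuous and \<open>K\<close> is compact and
  non-empty.
\<close>

definition norm_diameter :: "(real ^ 'n \<Rightarrow> real) \<Rightarrow> (real ^ 'n) set \<Rightarrow> real" where
  "norm_diameter N K = (SUP (x, y)\<in>K \<times> K. N (x - y))"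

definition nonsingular_affine_map :: "(real ^ 'n \<Rightarrow> real ^ 'n) \<Rightarrow> bool" where
  "nonsingular_affine_map f \<longleftrightarrow>
     (\<exists>(A :: real ^ 'n ^ 'n) b. invertible A \<and> f = (\<lambda>x. A *v x + b))"

definition parallelotope :: "(real ^ 'n) set \<Rightarrow> bool" where
  "parallelotope P \<longleftrightarrow>
     (\<exists>f. nonsingular_affine_map f \<and> P = f ` {x. \<forall>i. - 1 \<le> x $ i \<and> x $ i \<le> 1})"

definition cross_polytope :: "(real ^ 'n) set \<Rightarrow> bool" where
  "cross_polytope P \<longleftrightarrow>
     (\<exists>f. nonsingular_affine_map f \<and>
          P = f ` (convex hull (\<Union>i. {axis i 1, - axis i 1})))"

end

theory Submission
  imports Defs
begin

text \<open>
  If lower-dimensional bodies satisfy \<open>D = 2R\<close>, then for \<open>n\<close> functionals with \<open>\<Sum>i. f i = 0\<close> and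
  points \<open>p i\<close> with mutual distances at most \<open>d\<close> one has \<open>\<Sum>i. f i \<bullet> p i \<le> d/2 * (\<Sum>i. \<parallel>f i\<parallel>)\<close>. By
  duality every zero-sum family splits as \<open>f i = (\<Sum>j. g i j - g j i)\<close> without loss of norm. Applied
  to multiples of extreme points of the dual ball this says that at most \<open>n - 1\<close> extreme points,
  no two of them antipodal, have additive norms. Choose a basis \<open>b\<close> of extreme points. If there are
  no others up to sign, the ball is a parallelotope. Otherwise an extreme point \<open>e = (\<Sum>i. c i *\<^sub>R b i)\<close>
  gives a relation among \<open>n + 1\<close> extreme points in which any two terms carry half of the total weight.
  This forces equal weights and \<open>n = 3\<close>, \<open>e\<close> is unique up to sign, and the dual ball is a
  parallelepiped.

  Conversely, in a cross-polytope norm the existence of a center reduces to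
  \<open>\<Sum>k. g k \<bullet> p k \<le> 2D\<close> for the four facet functionals, which sum to zero, and four points of the
  body, which are coplanar and hence affinely dependent.
\<close>

section \<open>Norms and dual norms\<close>

lemma
  assumes "is_norm N"
  shows is_norm_nonneg: "0 \<le> N x"
    and is_norm_eq_0: "N x = 0 \<longleftrightarrow> x = 0"
    and is_norm_scaleR: "N (a *\<^sub>R x) = \<bar>a\<bar> * N x"
    and is_norm_triangle: "N (x + y) \<le> N x + N y"
  using assms by (auto simp: is_norm_def)

lemma is_norm_zero: "is_norm N \<Longrightarrow> N 0 = 0"
  by (simp add: is_norm_eq_0)

lemma is_norm_minus: "is_norm N \<Longrightarrow> N (- x) = N x"
  using is_norm_scaleR[of N "-1" x] by simp

lemma is_norm_diff_commute: "is_norm N \<Longrightarrow> N (x - y) = N (y - x)"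
  using is_norm_minus[of N "x - y"] by simp

lemma is_norm_sum:
  assumes "is_norm N"
  shows "N (sum f A) \<le> (\<Sum>i\<in>A. N (f i))"
proof (induction A rule: infinite_finite_induct)
  case (insert x F)
  then show ?case using is_norm_triangle[OF assms, of "f x" "sum f F"] by simp
qed (use is_norm_zero[OF assms] in auto)

lemma is_norm_convex_on:
  assumes "is_norm N"
  shows "convex_on UNIV N"
proof (rule convex_onI)
  fix t :: real and x y :: "real ^ 'a"
  assume "0 < t" "t < 1"
  then show "N ((1 - t) *\<^sub>R x + t *\<^sub>R y) \<le> (1 - t) * N x + t * N y"
    using is_norm_triangle[OF assms, of "(1 - t) *\<^sub>R x" "t *\<^sub>R y"]
    by (simp add: is_norm_scaleR[OF assms])
qed auto

text \<open>A finite convex function on an open subset of a finite-dimensional space is continuous;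
  this links \<open>N\<close> to the Euclidean topology.\<close>

lemma is_norm_continuous_on: "is_norm N \<Longrightarrow> continuous_on S N"
  using convex_on_continuous[OF open_UNIV is_norm_convex_on] continuous_on_subset by blast

lemma convex_norm_le: "is_norm N \<Longrightarrow> convex {x. N (x - c) \<le> r}"
proof (rule convexI)
  fix x y and u v :: real
  assume N: "is_norm N" and xy: "x \<in> {x. N (x - c) \<le> r}" "y \<in> {x. N (x - c) \<le> r}"
    and uv: "0 \<le> u" "0 \<le> v" "u + v = 1"
  have eq: "u *\<^sub>R x + v *\<^sub>R y - c = u *\<^sub>R (x - c) + v *\<^sub>R (y - c)"
    using uv(3) by (simp add: algebra_simps flip: scaleR_add_left)
  have "N (u *\<^sub>R x + v *\<^sub>R y - c) \<le> u * N (x - c) + v * N (y - c)"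
    unfolding eq using is_norm_triangle[OF N, of "u *\<^sub>R (x - c)" "v *\<^sub>R (y - c)"] uv
    by (simp add: is_norm_scaleR[OF N])
  also have "\<dots> \<le> r"
    using xy uv by (intro convex_bound_le) auto
  finally show "u *\<^sub>R x + v *\<^sub>R y \<in> {x. N (x - c) \<le> r}" by simp
qed

text \<open>\<open>N\<close> attains a positive minimum on the compact Euclidean sphere, and
  homogeneity carries the bound to all vectors.\<close>

lemma norm_le_is_norm:
  assumes "is_norm N"
  obtains C where "0 < C" "\<And>x. norm x \<le> C * N x"
proof -
  let ?S = "sphere 0 1 :: (real ^ 'a) set"
  have "?S \<noteq> {}"
    using norm_axis_1 by (metis dist_0_norm empty_iff mem_sphere)
  then obtain z where z: "z \<in> ?S" "\<And>y. y \<in> ?S \<Longrightarrow> N z \<le> N y"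
    using continuous_attains_inf[of ?S N] is_norm_continuous_on[OF assms] by auto
  have "N z > 0"
    using z(1) is_norm_nonneg[OF assms, of z] is_norm_eq_0[OF assms, of z] by fastforce
  moreover have "norm x \<le> (1 / N z) * N x" for x
  proof (cases "x = 0")
    case False
    then have "N z \<le> N ((1 / norm x) *\<^sub>R x)"
      by (intro z(2)) simp
    also have "\<dots> = N x / norm x"
      by (simp add: is_norm_scaleR[OF assms])
    finally show ?thesis
      using False \<open>N z > 0\<close> by (simp add: field_simps)
  qed (simp add: is_norm_zero[OF assms])
  ultimately show ?thesis using that[of "1 / N z"] by simp
qed

lemma convex_unit_ball: "is_norm N \<Longrightarrow> convex (unit_ball N)"
  using convex_norm_le[of N 0 1] by (simp add: unit_ball_def)

lemma compact_unit_ball: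
  assumes "is_norm N"
  shows "compact (unit_ball N)"
proof -
  obtain C where C: "0 < C" "\<And>x. norm x \<le> C * N x"
    using norm_le_is_norm[OF assms] by blast
  have "bounded (unit_ball N)"
  proof (rule boundedI)
    fix x assume "x \<in> unit_ball N"
    then have "C * N x \<le> C * 1"
      using C(1) by (intro mult_left_mono) (auto simp: unit_ball_def)
    with C(2)[of x] show "norm x \<le> C" by simp
  qed
  moreover have "closed (unit_ball N)"
    unfolding unit_ball_def
    by (intro closed_Collect_le is_norm_continuous_on[OF assms] continuous_intros)
  ultimately show ?thesis by (simp add: compact_eq_bounded_closed)
qed

section \<open>The dual norm, with functionals represented by Euclidean inner products\<close>

definition dual_norm :: "(real ^ 'n \<Rightarrow> real) \<Rightarrow> real ^ 'n \<Rightarrow> real" where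
  "dual_norm N f = (SUP x\<in>unit_ball N. f \<bullet> x)"

lemma dual_norm_attained:
  assumes "is_norm N"
  obtains x where "x \<in> unit_ball N" "dual_norm N f = f \<bullet> x"
    "\<And>y. y \<in> unit_ball N \<Longrightarrow> f \<bullet> y \<le> dual_norm N f"
proof -
  have "0 \<in> unit_ball N" by (simp add: unit_ball_def is_norm_zero[OF assms])
  then obtain x where x: "x \<in> unit_ball N" "\<And>y. y \<in> unit_ball N \<Longrightarrow> f \<bullet> y \<le> f \<bullet> x"
    using continuous_attains_sup[of "unit_ball N" "\<lambda>x. f \<bullet> x"] compact_unit_ball[OF assms]
    by (force intro: continuous_intros)
  then have "dual_norm N f = f \<bullet> x"
    unfolding dual_norm_def by (intro cSup_eq_maximum) auto
  with x that show ?thesis by auto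
qed

lemma inner_le_dual_norm: "is_norm N \<Longrightarrow> N x \<le> 1 \<Longrightarrow> f \<bullet> x \<le> dual_norm N f"
  by (rule dual_norm_attained[of N f]) (auto simp: unit_ball_def)

lemma is_norm_dual_norm:
  assumes N: "is_norm N"
  shows "is_norm (dual_norm N)"
proof -
  have nonneg: "0 \<le> dual_norm N f" for f
    using inner_le_dual_norm[OF N, of 0 f] by (simp add: is_norm_zero[OF N])
  have zero: "f = 0" if "dual_norm N f = 0" for f
  proof (rule ccontr)
    assume "f \<noteq> 0"
    then have p: "N f > 0"
      using is_norm_nonneg[OF N, of f] is_norm_eq_0[OF N, of f] by linarith
    then have "f \<bullet> ((1 / N f) *\<^sub>R f) \<le> dual_norm N f"
      by (intro inner_le_dual_norm[OF N]) (simp add: is_norm_scaleR[OF N])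
    with that p have "f \<bullet> f \<le> 0"
      by (simp add: divide_le_0_iff)
    with \<open>f \<noteq> 0\<close> show False
      using inner_gt_zero_iff[of f] by linarith
  qed
  have le: "dual_norm N (a *\<^sub>R f) \<le> \<bar>a\<bar> * dual_norm N f" for a f
  proof -
    obtain x where x: "x \<in> unit_ball N" "dual_norm N (a *\<^sub>R f) = (a *\<^sub>R f) \<bullet> x"
      by (rule dual_norm_attained[OF N])
    have "f \<bullet> (sgn a *\<^sub>R x) \<le> dual_norm N f"
      using x(1) by (intro inner_le_dual_norm[OF N])
        (auto simp: unit_ball_def is_norm_scaleR[OF N] abs_sgn_eq is_norm_nonneg[OF N])
    then have "\<bar>a\<bar> * (f \<bullet> (sgn a *\<^sub>R x)) \<le> \<bar>a\<bar> * dual_norm N f"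
      by (intro mult_left_mono) auto
    moreover have "\<bar>a\<bar> * (f \<bullet> (sgn a *\<^sub>R x)) = (a *\<^sub>R f) \<bullet> x"
      by (cases a "0::real" rule: linorder_cases) auto
    ultimately show ?thesis using x(2) by linarith
  qed
  have scale: "dual_norm N (a *\<^sub>R f) = \<bar>a\<bar> * dual_norm N f" for a f
  proof (cases "a = 0")
    case True
    then show ?thesis using le[of 0 f] nonneg[of 0] by simp
  next
    case False
    have "dual_norm N f \<le> \<bar>1 / a\<bar> * dual_norm N (a *\<^sub>R f)"
      using le[of "1 / a" "a *\<^sub>R f"] False by simp
    then show ?thesis using le[of a f] False by (simp add: field_simps)
  qed
  have tri: "dual_norm N (f + g) \<le> dual_norm N f + dual_norm N g" for f g
  proof -
    obtain x where x: "x \<in> unit_ball N" "dual_norm N (f + g) = (f + g) \<bullet> x"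
      by (rule dual_norm_attained[OF N])
    then show ?thesis
      using inner_le_dual_norm[OF N, of x f] inner_le_dual_norm[OF N, of x g]
      by (simp add: unit_ball_def inner_add_left)
  qed
  show ?thesis
    unfolding is_norm_def using nonneg zero scale tri scale[of 0 0] by auto
qed

lemma inner_le_dual_norm_mult:
  assumes N: "is_norm N"
  shows "f \<bullet> x \<le> dual_norm N f * N x"
proof (cases "x = 0")
  case False
  then have p: "N x > 0"
    using is_norm_nonneg[OF N, of x] is_norm_eq_0[OF N, of x] by linarith
  then have "f \<bullet> ((1 / N x) *\<^sub>R x) \<le> dual_norm N f"
    by (intro inner_le_dual_norm[OF N]) (simp add: is_norm_scaleR[OF N])
  with p show ?thesis by (simp add: field_simps)
qed (simp add: is_norm_zero[OF N])

text \<open>Bidual inequality: a point outside a closed ball is separated from it by a hyperplane,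
  whose normal rescales to a member of the dual ball that violates the bound
  \<open>t\<close>.\<close>

lemma norm_le_if_dual_ball_le:
  assumes N: "is_norm N" and t: "0 \<le> t"
    and u: "\<And>u. u \<in> unit_ball (dual_norm N) \<Longrightarrow> u \<bullet> x \<le> t"
  shows "N x \<le> t"
proof (rule ccontr)
  assume "\<not> N x \<le> t"
  \<comment> \<open>A radius strictly between \<open>t\<close> and \<open>N x\<close> is positive
    even if \<open>t = 0\<close>, as the rescaling of the normal requires.\<close>
  define t' where "t' = (t + N x) / 2"
  have t': "t < t'" "t' < N x" "0 < t'"
    using \<open>\<not> N x \<le> t\<close> t by (auto simp: t'_def)
  have "closed {y. N y \<le> t'}"
    by (intro closed_Collect_le is_norm_continuous_on[OF N] continuous_intros)
  moreover have "convex {y. N y \<le> t'}"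
    using convex_norm_le[OF N, of 0] by simp
  ultimately obtain a b where ab: "a \<bullet> x < b" "\<And>y. N y \<le> t' \<Longrightarrow> b < a \<bullet> y"
    using separating_hyperplane_closed_point[of "{y. N y \<le> t'}" x] t'(2) by auto
  have b: "b < 0" using ab(2)[of 0] t' by (simp add: is_norm_zero[OF N])
  \<comment> \<open>Since \<open>b\<close> is negative, the factor \<open>t' / b\<close> flips the
    normal, so that \<open>u\<close> is at most 1 on the unit ball and exceeds \<open>t'\<close> at
    \<open>x\<close>.\<close>
  define u where "u = (t' / b) *\<^sub>R a"
  have "u \<bullet> y \<le> 1" if "N y \<le> 1" for y
  proof -
    have "b < a \<bullet> (t' *\<^sub>R y)"
      using that t' by (intro ab(2)) (simp add: is_norm_scaleR[OF N])
    then show ?thesis using b by (simp add: u_def field_simps)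
  qed
  then have "dual_norm N u \<le> 1"
    using dual_norm_attained[OF N, of u] by (metis mem_Collect_eq unit_ball_def)
  then have "u \<bullet> x \<le> t" by (intro \<open>\<And>u. u \<in> unit_ball (dual_norm N) \<Longrightarrow> u \<bullet> x \<le> t\<close>) (simp add: unit_ball_def)
  moreover have "u \<bullet> x > t'"
    using ab(1) b t' by (simp add: u_def field_simps)
  ultimately show False using t' by simp
qed

text \<open>By Krein-Milman the extreme points generate the dual ball, so a bound by 1 on them
  passes to the whole dual ball and, through the bidual inequality, to \<open>N x\<close>.\<close>

lemma norm_le_iff_extreme:
  assumes N: "is_norm N"
  shows "N x \<le> 1 \<longleftrightarrow> (\<forall>e. e extreme_point_of unit_ball (dual_norm N) \<longrightarrow> e \<bullet> x \<le> 1)"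
proof
  assume "N x \<le> 1"
  show "\<forall>e. e extreme_point_of unit_ball (dual_norm N) \<longrightarrow> e \<bullet> x \<le> 1"
  proof (intro allI impI)
    fix e assume "e extreme_point_of unit_ball (dual_norm N)"
    then have "dual_norm N e \<le> 1" by (simp add: extreme_point_of_def unit_ball_def)
    then show "e \<bullet> x \<le> 1" using inner_le_dual_norm[OF N \<open>N x \<le> 1\<close>, of e] by simp
  qed
next
  assume *: "\<forall>e. e extreme_point_of unit_ball (dual_norm N) \<longrightarrow> e \<bullet> x \<le> 1"
  note D = is_norm_dual_norm[OF N]
  have "convex hull {e. e extreme_point_of unit_ball (dual_norm N)} \<subseteq> {u. u \<bullet> x \<le> 1}"
    using * convex_halfspace_le[of x 1] by (intro hull_minimal) (auto simp: inner_commute)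
  then have "unit_ball (dual_norm N) \<subseteq> {u. u \<bullet> x \<le> 1}"
    using Krein_Milman_Minkowski[OF compact_unit_ball[OF D] convex_unit_ball[OF D]] by metis
  then show "N x \<le> 1" by (intro norm_le_if_dual_ball_le[OF N]) auto
qed

section \<open>Diameter and circumradius\<close>

lemma norm_diff_le_diameter:
  assumes N: "is_norm N" and K: "compact K" and xy: "x \<in> K" "y \<in> K"
  shows "N (x - y) \<le> norm_diameter N K"
proof -
  have "compact ((\<lambda>(x, y). N (x - y)) ` (K \<times> K))"
    unfolding case_prod_unfold
    using K by (intro compact_continuous_image compact_Times
        continuous_on_compose2[OF is_norm_continuous_on[OF N, of UNIV]] continuous_intros) auto
  then have "bdd_above ((\<lambda>(x, y). N (x - y)) ` (K \<times> K))"
    by (intro bounded_imp_bdd_above compact_imp_bounded)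
  then have "(\<lambda>(x, y). N (x - y)) (x, y) \<le> norm_diameter N K"
    unfolding norm_diameter_def using xy by (intro cSUP_upper) auto
  then show ?thesis by simp
qed

lemma norm_diameter_le:
  assumes "K \<noteq> {}" "\<And>x y. x \<in> K \<Longrightarrow> y \<in> K \<Longrightarrow> N (x - y) \<le> d"
  shows "norm_diameter N K \<le> d"
  unfolding norm_diameter_def using assms by (intro cSUP_least) auto

lemma subset_scaled_unit_ball_iff:
  assumes N: "is_norm N" and "0 \<le> r"
  shows "K \<subseteq> (\<lambda>x. c + r *\<^sub>R x) ` unit_ball N \<longleftrightarrow> (\<forall>x\<in>K. N (x - c) \<le> r)"
proof -
  have "x \<in> (\<lambda>x. c + r *\<^sub>R x) ` unit_ball N \<longleftrightarrow> N (x - c) \<le> r" for x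
  proof
    assume "x \<in> (\<lambda>x. c + r *\<^sub>R x) ` unit_ball N"
    then obtain y where "N y \<le> 1" "x = c + r *\<^sub>R y" by (auto simp: unit_ball_def)
    then show "N (x - c) \<le> r"
      using \<open>0 \<le> r\<close> by (simp add: is_norm_scaleR[OF N] mult_left_le)
  next
    assume *: "N (x - c) \<le> r"
    show "x \<in> (\<lambda>x. c + r *\<^sub>R x) ` unit_ball N"
    proof (cases "r = 0")
      case True
      then have "x = c"
        using * is_norm_nonneg[OF N, of "x - c"] is_norm_eq_0[OF N, of "x - c"] by simp
      then show ?thesis
        using True by (intro image_eqI[of _ _ 0]) (simp_all add: unit_ball_def is_norm_zero[OF N])
    next
      case False
      then show ?thesis
        using * \<open>0 \<le> r\<close> by (intro image_eqI[of _ _ "(1 / r) *\<^sub>R (x - c)"])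
          (simp_all add: unit_ball_def is_norm_scaleR[OF N])
    qed
  qed
  then show ?thesis by blast
qed

lemma circumradius_le:
  assumes N: "is_norm N" and "0 \<le> r" "\<And>x. x \<in> K \<Longrightarrow> N (x - c) \<le> r"
  shows "circumradius N K \<le> r"
  unfolding circumradius_def
  using assms subset_scaled_unit_ball_iff[OF N \<open>0 \<le> r\<close>, of K c]
  by (intro cInf_lower bdd_belowI[of _ 0]) auto

lemma le_circumradius:
  assumes N: "is_norm N" and "compact K"
    and *: "\<And>r c. 0 \<le> r \<Longrightarrow> (\<And>x. x \<in> K \<Longrightarrow> N (x - c) \<le> r) \<Longrightarrow> a \<le> r"
  shows "a \<le> circumradius N K"
  unfolding circumradius_def
proof (rule cInf_greatest)
  \<comment> \<open>The infimum is taken over a non-empty set of radii: a bound for \<open>N\<close>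
    on \<open>K\<close> supplies a radius with center 0.\<close>
  have "compact (N ` K)"
    using assms(2) by (intro compact_continuous_image is_norm_continuous_on[OF N])
  then obtain B where B: "\<forall>x\<in>K. norm (N x) \<le> B" "0 < B"
    by (auto dest!: compact_imp_bounded simp: bounded_pos)
  then have "\<forall>x\<in>K. N (x - 0) \<le> B" by fastforce
  then have "K \<subseteq> (\<lambda>x. 0 + B *\<^sub>R x) ` unit_ball N"
    using subset_scaled_unit_ball_iff[OF N, of B K 0] \<open>0 < B\<close> by (metis less_imp_le)
  then have "B \<in> {r. 0 \<le> r \<and> (\<exists>c. K \<subseteq> (\<lambda>x. c + r *\<^sub>R x) ` unit_ball N)}"
    using \<open>0 < B\<close> by (intro CollectI conjI exI[of _ 0]) auto
  then show "{r. 0 \<le> r \<and> (\<exists>c. K \<subseteq> (\<lambda>x. c + r *\<^sub>R x) ` unit_ball N)} \<noteq> {}" by blast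
next
  fix r assume "r \<in> {r. 0 \<le> r \<and> (\<exists>c. K \<subseteq> (\<lambda>x. c + r *\<^sub>R x) ` unit_ball N)}"
  then obtain c where "0 \<le> r" "\<forall>x\<in>K. N (x - c) \<le> r"
    using subset_scaled_unit_ball_iff[OF N] by blast
  then show "a \<le> r" using *[of r c] by blast
qed

text \<open>The triangle inequality through any center gives D \<le> 2R, so a center within half the
  diameter of every point forces equality.\<close>

lemma diameter_eq_if_center:
  assumes N: "is_norm N" and K: "compact K" "K \<noteq> {}"
    and c: "\<And>x. x \<in> K \<Longrightarrow> N (x - c) \<le> norm_diameter N K / 2"
  shows "norm_diameter N K = 2 * circumradius N K"
proof (rule antisym)
  have "norm_diameter N K / 2 \<le> circumradius N K"
  proof (rule le_circumradius[OF N K(1)])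
    fix r a assume a: "\<And>x. x \<in> K \<Longrightarrow> N (x - a) \<le> r"
    have "norm_diameter N K \<le> 2 * r"
    proof (rule norm_diameter_le[OF K(2)])
      fix x y assume "x \<in> K" "y \<in> K"
      then show "N (x - y) \<le> 2 * r"
        using is_norm_triangle[OF N, of "x - a" "a - y"] a[of x] a[of y]
          is_norm_diff_commute[OF N, of a y] by simp
    qed
    then show "norm_diameter N K / 2 \<le> r" by simp
  qed
  then show "norm_diameter N K \<le> 2 * circumradius N K" by simp
next
  obtain z where "z \<in> K" using K(2) by blast
  then have "0 \<le> norm_diameter N K"
    using norm_diff_le_diameter[OF N K(1), of z z] is_norm_zero[OF N] by simp
  then have "circumradius N K \<le> norm_diameter N K / 2"
    using c by (intro circumradius_le[OF N]) auto
  then show "2 * circumradius N K \<le> norm_diameter N K" by simp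
qed

section \<open>Inner product bound from the diameter property\<close>

definition lowdim_diameter_property :: "(real ^ 'n \<Rightarrow> real) \<Rightarrow> bool" where
  "lowdim_diameter_property N \<longleftrightarrow>
     (\<forall>K :: (real ^ 'n) set. convex_body K \<and> aff_dim K \<le> int CARD('n) - 1 \<longrightarrow>
        norm_diameter N K = 2 * circumradius N K)"

text \<open>The hull of \<open>n\<close> points has affine dimension at most \<open>n - 1\<close>,
  so its circumradius is at most \<open>d / 2\<close>. Evaluating the functionals relative to a
  center changes nothing because they sum to zero.\<close>

lemma lowdim_diameter_inner_bound:
  fixes f p :: "'n::finite \<Rightarrow> real ^ 'n"
  assumes N: "is_norm N" and P: "lowdim_diameter_property N"
    and f: "(\<Sum>i\<in>UNIV. f i) = 0" and d: "\<And>i j. N (p i - p j) \<le> d"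
  shows "(\<Sum>i\<in>UNIV. f i \<bullet> p i) \<le> d / 2 * (\<Sum>i\<in>UNIV. dual_norm N (f i))"
proof -
  define s where "s = (\<Sum>i\<in>UNIV. dual_norm N (f i))"
  define K where "K = convex hull (range p)"
  note D = is_norm_dual_norm[OF N]
  have s: "0 \<le> s" unfolding s_def by (intro sum_nonneg is_norm_nonneg[OF D])
  have K: "compact K" "convex K" "K \<noteq> {}"
    by (auto simp: K_def finite_imp_compact_convex_hull)
  have p: "p i \<in> K" for i by (simp add: K_def hull_inc)
  have "aff_dim K \<le> int (card (range p)) - 1"
    using aff_dim_le_card[of "range p"] by (simp add: K_def aff_dim_convex_hull)
  also have "\<dots> \<le> int CARD('n) - 1"
    using card_image_le[of UNIV p] by simp
  finally have eq: "norm_diameter N K = 2 * circumradius N K"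
    using P K by (auto simp: lowdim_diameter_property_def convex_body_def)
  have 1: "N (x - p j) \<le> d" if "x \<in> K" for x j
  proof -
    have "K \<subseteq> {x. N (x - p j) \<le> d}"
      unfolding K_def using d by (intro hull_minimal convex_norm_le[OF N]) auto
    with that show ?thesis by auto
  qed
  have "N (y - x) \<le> d" if "x \<in> K" "y \<in> K" for x y
  proof -
    have "K \<subseteq> {y. N (y - x) \<le> d}"
      unfolding K_def using 1[OF that(1)] is_norm_diff_commute[OF N]
      by (intro hull_minimal convex_norm_le[OF N]) auto
    with that show ?thesis by auto
  qed
  then have "norm_diameter N K \<le> d"
    by (intro norm_diameter_le[OF K(3)])
  show ?thesis
  proof (cases "s = 0")
    case True
    then have "f i = 0" for i
      using is_norm_nonneg[OF D] is_norm_eq_0[OF D]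
      by (simp add: s_def sum_nonneg_eq_0_iff)
    then show ?thesis by (simp add: is_norm_zero[OF D])
  next
    case False
    have "(\<Sum>i\<in>UNIV. f i \<bullet> p i) / s \<le> circumradius N K"
    proof (rule le_circumradius[OF N K(1)])
      fix r c assume r: "0 \<le> r" and c: "\<And>x. x \<in> K \<Longrightarrow> N (x - c) \<le> r"
      have "(\<Sum>i\<in>UNIV. f i \<bullet> p i) = (\<Sum>i\<in>UNIV. f i \<bullet> (p i - c))"
        by (simp add: inner_diff_right sum_subtractf flip: inner_sum_left) (simp add: f)
      also have "\<dots> \<le> (\<Sum>i\<in>UNIV. dual_norm N (f i) * r)"
      proof (rule sum_mono)
        fix i
        show "f i \<bullet> (p i - c) \<le> dual_norm N (f i) * r"
          using inner_le_dual_norm_mult[OF N, of "f i" "p i - c"]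
            mult_left_mono[OF c[OF p[of i]] is_norm_nonneg[OF D, of "f i"]] by linarith
      qed
      finally have "(\<Sum>i\<in>UNIV. f i \<bullet> p i) \<le> s * r"
        by (simp add: s_def sum_distrib_right)
      then show "(\<Sum>i\<in>UNIV. f i \<bullet> p i) / s \<le> r"
        using s False by (simp add: field_simps)
    qed
    then have "(\<Sum>i\<in>UNIV. f i \<bullet> p i) / s \<le> d / 2"
      using eq \<open>norm_diameter N K \<le> d\<close> by linarith
    then show ?thesis using s False by (simp add: field_simps flip: s_def)
  qed
qed

section \<open>Extreme points of the dual ball\<close>

text \<open>A nonzero vector shorter than 1 lies between the origin and its normalization, and the
  origin lies between two opposite unit vectors; neither is extreme.\<close>

lemma extreme_point_norm_eq_1:
  fixes e :: "real ^ 'n"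
  assumes D: "is_norm D" and e: "e extreme_point_of unit_ball D"
  shows "D e = 1"
proof (rule ccontr)
  assume "D e \<noteq> 1"
  with e have less: "D e < 1" by (simp add: extreme_point_of_def unit_ball_def)
  have no: "e \<notin> open_segment a b" if "D a \<le> 1" "D b \<le> 1" for a b
    using e that by (simp add: extreme_point_of_def unit_ball_def)
  show False
  proof (cases "e = 0")
    case True
    obtain v :: "real ^ 'n" where v: "v \<noteq> 0" using axis_eq_0_iff[of _ "1::real"] by auto
    define w where "w = (1 / D v) *\<^sub>R v"
    have "D v > 0" using v is_norm_nonneg[OF D, of v] is_norm_eq_0[OF D, of v] by linarith
    then have w: "D w = 1" by (simp add: w_def is_norm_scaleR[OF D])
    then have "w \<noteq> 0" using is_norm_zero[OF D] by force
    then have "0 \<in> open_segment w (- w)"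
      unfolding in_segment by (auto intro!: exI[of _ "1 / 2"]
          simp: equation_minus_iff[of w] algebra_simps eq_neg_iff_add_eq_0 simp flip: scaleR_2)
    then show False using no[of w "- w"] w True by (simp add: is_norm_minus[OF D])
  next
    case False
    then have p: "D e > 0" using is_norm_nonneg[OF D, of e] is_norm_eq_0[OF D, of e] by linarith
    then have "e \<in> open_segment 0 ((1 / D e) *\<^sub>R e)"
      unfolding in_segment using less False by (auto intro!: exI[of _ "D e"])
    then show False using no[of 0 "(1 / D e) *\<^sub>R e"] p
      by (simp add: is_norm_zero[OF D] is_norm_scaleR[OF D])
  qed
qed

lemma extreme_point_neq_minus:
  assumes D: "is_norm D" and e: "e extreme_point_of unit_ball D"
  shows "e \<noteq> - e"
  using extreme_point_norm_eq_1[OF D e] is_norm_zero[OF D]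
  by (auto simp: eq_neg_iff_add_eq_0 simp flip: scaleR_2)

text \<open>Equality holds in the triangle inequality. If both summands are nonzero,
  \<open>e\<close> is a proper convex combination of their normalizations, and extremality makes
  these equal to \<open>e\<close>.\<close>

lemma extreme_point_summand:
  assumes D: "is_norm D" and e: "e extreme_point_of unit_ball D"
    and sum: "h + r = a *\<^sub>R e" and le: "D h + D r \<le> a"
  shows "h = D h *\<^sub>R e"
proof -
  have De: "D e = 1" by (rule extreme_point_norm_eq_1[OF D e])
  have h0: "0 \<le> D h" and r0: "0 \<le> D r" by (simp_all add: is_norm_nonneg[OF D])
  have "a = D (h + r)" using h0 r0 le by (simp add: sum is_norm_scaleR[OF D] De)
  also have "\<dots> \<le> D h + D r" by (rule is_norm_triangle[OF D])
  finally have a: "a = D h + D r" using le by simp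
  consider "D h = 0" | "D r = 0" | "0 < D h" "0 < D r" using h0 r0 by linarith
  then show ?thesis
  proof cases
    case 1
    then show ?thesis by (simp add: is_norm_eq_0[OF D])
  next
    case 2
    then show ?thesis using sum a is_norm_eq_0[OF D, of r] by simp
  next
    case 3
    define u v where "u = (1 / D h) *\<^sub>R h" and "v = (1 / D r) *\<^sub>R r"
    have uv: "D u = 1" "D v = 1" "h = D h *\<^sub>R u" "r = D r *\<^sub>R v"
      using 3 by (simp_all add: u_def v_def is_norm_scaleR[OF D])
    have "e = (1 / a) *\<^sub>R (h + r)" using 3 a sum by simp
    also have "\<dots> = (D h / a) *\<^sub>R u + (D r / a) *\<^sub>R v"
      by (subst uv(3), subst uv(4)) (simp add: scaleR_right_distrib)
    also have "D h / a = 1 - D r / a" using 3 a by (simp add: field_simps)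
    finally have e_eq: "e = (1 - D r / a) *\<^sub>R u + (D r / a) *\<^sub>R v" .
    have "u = v"
    proof (rule ccontr)
      assume "u \<noteq> v"
      then have "e \<in> open_segment u v"
        unfolding in_segment using e_eq 3 a by (auto intro!: exI[of _ "D r / a"])
      then show False using e uv by (auto simp: extreme_point_of_def unit_ball_def)
    qed
    with e_eq have "e = u" by (simp add: algebra_simps flip: scaleR_add_left)
    with uv(3) show ?thesis by simp
  qed
qed

text \<open>Duality: an unrepresentable family would be separated from the compact convex set of families
  \<open>\<Sum>j. g i j - g j i\<close> of small total norm by points \<open>p i\<close> that violate the inner product bound.\<close>

lemma zero_sum_decomposition:
  fixes f :: "'n::finite \<Rightarrow> real ^ 'n"
  assumes N: "is_norm N" and P: "lowdim_diameter_property N" and f: "(\<Sum>i\<in>UNIV. f i) = 0"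
  obtains g :: "'n \<Rightarrow> 'n \<Rightarrow> real ^ 'n" where
    "\<And>i. f i = (\<Sum>j\<in>UNIV. g i j - g j i)"
    "\<And>i. dual_norm N (f i) = (\<Sum>j\<in>UNIV. dual_norm N (g i j) + dual_norm N (g j i))"
proof -
  note D = is_norm_dual_norm[OF N]
  define s where "s = (\<Sum>i\<in>UNIV. dual_norm N (f i))"
  define T where "T g = (\<Sum>i\<in>UNIV. \<Sum>j\<in>UNIV. dual_norm N (g $ i $ j))" for g :: "real ^ 'n ^ 'n ^ 'n"
  \<comment> \<open>Each entry of \<open>g\<close> contributes to two components of
    \<open>L g\<close>, once with each sign, hence the budget \<open>s / 2\<close> in place of
    \<open>s\<close>.\<close>
  define G where "G = {g. T g \<le> s / 2}"
  define L :: "real ^ 'n ^ 'n ^ 'n \<Rightarrow> real ^ 'n ^ 'n"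
    where "L g = (\<chi> i. \<Sum>j\<in>UNIV. g $ i $ j - g $ j $ i)" for g
  have s: "0 \<le> s" unfolding s_def by (intro sum_nonneg is_norm_nonneg[OF D])
  have linL: "linear L"
    by (rule linearI)
      (simp_all add: L_def vec_eq_iff sum.distrib sum_subtractf scaleR_sum_right algebra_simps
         flip: sum_distrib_left)
  have contT: "continuous_on UNIV T"
    unfolding T_def
    by (intro continuous_intros continuous_on_compose2[OF is_norm_continuous_on[OF D, of UNIV]]) auto
  have "convex G"
  proof (rule convexI)
    fix x y and u v :: real
    assume xy: "x \<in> G" "y \<in> G" and uv: "0 \<le> u" "0 \<le> v" "u + v = 1"
    have "T (u *\<^sub>R x + v *\<^sub>R y) \<le>
        (\<Sum>i\<in>UNIV. \<Sum>j\<in>UNIV. u * dual_norm N (x $ i $ j) + v * dual_norm N (y $ i $ j))"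
      unfolding T_def
    proof (intro sum_mono)
      fix i j
      show "dual_norm N ((u *\<^sub>R x + v *\<^sub>R y) $ i $ j)
          \<le> u * dual_norm N (x $ i $ j) + v * dual_norm N (y $ i $ j)"
        using is_norm_triangle[OF D, of "u *\<^sub>R x $ i $ j" "v *\<^sub>R y $ i $ j"] uv
        by (simp add: is_norm_scaleR[OF D])
    qed
    also have "\<dots> = u * T x + v * T y"
      by (simp add: T_def sum.distrib sum_distrib_left)
    also have "\<dots> \<le> s / 2"
      using xy uv by (intro convex_bound_le) (auto simp: G_def)
    finally show "u *\<^sub>R x + v *\<^sub>R y \<in> G" by (simp add: G_def)
  qed
  have "closed G"
    unfolding G_def by (intro closed_Collect_le contT continuous_intros)
  moreover have "bounded G"
  proof -
    obtain C where C: "0 < C" "\<And>x. norm x \<le> C * dual_norm N x"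
      using norm_le_is_norm[OF D] by blast
    have "norm g \<le> C * (s / 2)" if "g \<in> G" for g
    proof -
      have "norm g \<le> (\<Sum>i\<in>UNIV. norm (g $ i))"
        unfolding norm_vec_def by (intro L2_set_le_sum) auto
      also have "\<dots> \<le> (\<Sum>i\<in>UNIV. \<Sum>j\<in>UNIV. norm (g $ i $ j))"
        by (intro sum_mono) (subst norm_vec_def, intro L2_set_le_sum, auto)
      also have "\<dots> \<le> (\<Sum>i\<in>UNIV. \<Sum>j\<in>UNIV. C * dual_norm N (g $ i $ j))"
        by (intro sum_mono C(2))
      also have "\<dots> = C * T g" by (simp add: T_def sum_distrib_left)
      also have "\<dots> \<le> C * (s / 2)" using that C(1) by (simp add: G_def)
      finally show ?thesis .
    qed
    then show ?thesis by (intro boundedI)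
  qed
  ultimately have "compact G" by (simp add: compact_eq_bounded_closed)
  then have "closed (L ` G)"
    by (intro compact_imp_closed compact_continuous_image linear_continuous_on
          linear_conv_bounded_linear[THEN iffD1] linL)
  have "(\<chi> i. f i) \<in> L ` G"
  proof (rule ccontr)
    assume "(\<chi> i. f i) \<notin> L ` G"
    then obtain a b where ab: "a \<bullet> (\<chi> i. f i) < b" "\<And>h. h \<in> L ` G \<Longrightarrow> b < a \<bullet> h"
      using separating_hyperplane_closed_point[of "L ` G" "\<chi> i. f i"]
        convex_linear_image[OF linL \<open>convex G\<close>] \<open>closed (L ` G)\<close> by blast
    have "0 \<in> G" using s by (simp add: G_def T_def is_norm_zero[OF D])
    then have "L 0 \<in> L ` G" by blast
    then have b: "b < 0" using ab(2)[of "L 0"] linear_0[OF linL] by simp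
    define p where "p i = - (a $ i)" for i
    have s0: "s \<noteq> 0"
    proof
      assume "s = 0"
      then have "f i = 0" for i
        using is_norm_nonneg[OF D] is_norm_eq_0[OF D]
        by (simp add: s_def sum_nonneg_eq_0_iff)
      then have "a \<bullet> (\<chi> i. f i) = 0" by (simp add: inner_vec_def)
      with ab(1) b show False by simp
    qed
    \<comment> \<open>Testing the separation with a family whose only entry is
      \<open>(s / 2) *\<^sub>R u\<close> in position \<open>(i, j)\<close> bounds
      \<open>u \<bullet> (p i - p j)\<close> for each \<open>u\<close> in the dual ball.\<close>
    have "N (p i - p j) \<le> - 2 * b / s" for i j
    proof (rule norm_le_if_dual_ball_le[OF N])
      fix u assume u: "u \<in> unit_ball (dual_norm N)"
      define g :: "real ^ 'n ^ 'n ^ 'n"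
        where "g = (\<chi> k l. if k = i then if l = j then (s / 2) *\<^sub>R u else 0 else 0)"
      have g: "g $ k $ l = (if k = i then if l = j then (s / 2) *\<^sub>R u else 0 else 0)" for k l
        by (simp add: g_def)
      have "T g = (\<Sum>k\<in>UNIV. if k = i then dual_norm N ((s / 2) *\<^sub>R u) else 0)"
        unfolding T_def
        by (intro sum.cong) (auto simp: g is_norm_zero[OF D] if_distrib[of "dual_norm N"] cong: if_cong)
      also have "\<dots> = dual_norm N ((s / 2) *\<^sub>R u)" by simp
      also have "\<dots> \<le> s / 2"
        using u s by (simp add: is_norm_scaleR[OF D] unit_ball_def mult_left_le)
      finally have "b < a \<bullet> L g" by (intro ab(2)) (simp add: G_def)
      also have "a \<bullet> L g = (\<Sum>k\<in>UNIV. \<Sum>l\<in>UNIV. a $ k \<bullet> g $ k $ l) - (\<Sum>k\<in>UNIV. \<Sum>l\<in>UNIV. a $ k \<bullet> g $ l $ k)"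
        by (subst inner_vec_def) (simp add: L_def inner_sum_right inner_diff_right sum_subtractf)
      also have "(\<Sum>k\<in>UNIV. \<Sum>l\<in>UNIV. a $ k \<bullet> g $ l $ k) = (\<Sum>l\<in>UNIV. \<Sum>k\<in>UNIV. a $ k \<bullet> g $ l $ k)"
        by (rule sum.swap)
      also have "(\<Sum>l\<in>UNIV. \<Sum>k\<in>UNIV. a $ k \<bullet> g $ l $ k) = (\<Sum>l\<in>UNIV. if l = i then a $ j \<bullet> ((s / 2) *\<^sub>R u) else 0)"
        by (intro sum.cong) (auto simp: g if_distrib[of "inner _"] cong: if_cong)
      also have "(\<Sum>k\<in>UNIV. \<Sum>l\<in>UNIV. a $ k \<bullet> g $ k $ l) = (\<Sum>k\<in>UNIV. if k = i then a $ i \<bullet> ((s / 2) *\<^sub>R u) else 0)"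
        by (intro sum.cong) (auto simp: g if_distrib[of "inner _"] cong: if_cong)
      finally have "b < (s / 2) * ((a $ i - a $ j) \<bullet> u)"
        by (simp add: algebra_simps)
      then show "u \<bullet> (p i - p j) \<le> - 2 * b / s"
        using s s0 by (simp add: p_def inner_commute inner_diff_right field_simps)
    qed (use b s in \<open>simp add: divide_nonpos_nonneg\<close>)
    from lowdim_diameter_inner_bound[OF N P f this]
    have "(\<Sum>i\<in>UNIV. f i \<bullet> p i) \<le> - b"
      using s0 by (simp flip: s_def)
    moreover have "(\<Sum>i\<in>UNIV. f i \<bullet> p i) = - (a \<bullet> (\<chi> i. f i))"
      by (subst inner_vec_def) (simp add: p_def sum_negf inner_commute)
    ultimately show False using ab(1) by simp
  qed
  then obtain g where g: "T g \<le> s / 2" "(\<chi> i. f i) = L g" by (auto simp: G_def)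
  have eq: "f i = (\<Sum>j\<in>UNIV. g $ i $ j - g $ j $ i)" for i
    using arg_cong[OF g(2), of "\<lambda>x. x $ i"] by (simp add: L_def)
  \<comment> \<open>\<open>R i\<close> dominates the dual norm of \<open>f i\<close> for each
    \<open>i\<close>, while the total of \<open>R\<close> is at most \<open>s\<close>, so no
    inequality can be strict.\<close>
  define R where "R i = (\<Sum>j\<in>UNIV. dual_norm N (g $ i $ j) + dual_norm N (g $ j $ i))" for i
  have le: "dual_norm N (f i) \<le> R i" for i
  proof -
    have "dual_norm N (f i) \<le> (\<Sum>j\<in>UNIV. dual_norm N (g $ i $ j - g $ j $ i))"
      unfolding eq by (rule is_norm_sum[OF D])
    also have "\<dots> \<le> R i"
      unfolding R_def
    proof (rule sum_mono)
      fix j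
      show "dual_norm N (g $ i $ j - g $ j $ i) \<le> dual_norm N (g $ i $ j) + dual_norm N (g $ j $ i)"
        using is_norm_triangle[OF D, of "g $ i $ j" "- g $ j $ i"] by (simp add: is_norm_minus[OF D])
    qed
    finally show ?thesis .
  qed
  have "(\<Sum>i\<in>UNIV. R i) = T g + (\<Sum>i\<in>UNIV. \<Sum>j\<in>UNIV. dual_norm N (g $ j $ i))"
    by (simp add: R_def T_def sum.distrib)
  also have "(\<Sum>i\<in>UNIV. \<Sum>j\<in>UNIV. dual_norm N (g $ j $ i)) = T g"
    unfolding T_def by (rule sum.swap)
  finally have "(\<Sum>i\<in>UNIV. R i) \<le> s" using g(1) by simp
  have "dual_norm N (f i) = R i" for i
  proof (rule ccontr)
    assume "dual_norm N (f i) \<noteq> R i"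
    then have "s < (\<Sum>i\<in>UNIV. R i)"
      unfolding s_def using le by (intro sum_strict_mono_ex1) (auto simp: less_le)
    with \<open>(\<Sum>i\<in>UNIV. R i) \<le> s\<close> show False by simp
  qed
  with eq that[of "\<lambda>i j. g $ i $ j"] show ?thesis by (simp add: R_def)
qed

section \<open>Additivity of the dual norm on few extreme points\<close>

lemma extreme_point_summand_sum:
  assumes D: "is_norm D" and e: "e extreme_point_of unit_ball D"
    and sum: "(\<Sum>x\<in>A. h x) = a *\<^sub>R e" and le: "(\<Sum>x\<in>A. D (h x)) \<le> a"
    and A: "finite A" "x \<in> A"
  shows "h x = D (h x) *\<^sub>R e"
proof (rule extreme_point_summand[OF D e])
  show "h x + (\<Sum>y\<in>A - {x}. h y) = a *\<^sub>R e"
    using sum.remove[OF A, of h] sum by simp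
  show "D (h x) + D (\<Sum>y\<in>A - {x}. h y) \<le> a"
    using sum.remove[OF A, of "\<lambda>x. D (h x)"] le is_norm_sum[OF D, of h "A - {x}"] by linarith
qed

text \<open>Serves to treat the pieces \<open>g i k\<close> and \<open>g k i\<close> at a fixed
  \<open>i\<close> as one family, the boolean telling the two directions apart.\<close>

lemma sum_UNIV_bool_prod:
  fixes F :: "'a::finite \<times> bool \<Rightarrow> 'c :: comm_monoid_add"
  shows "(\<Sum>x\<in>UNIV. F x) = (\<Sum>k\<in>UNIV. F (k, True) + F (k, False))"
proof -
  have "(\<Sum>x\<in>UNIV. F x) = (\<Sum>k\<in>UNIV. \<Sum>b\<in>UNIV. F (k, b))"
    unfolding UNIV_Times_UNIV[symmetric] by (rule sum.cartesian_product')
  then show ?thesis by (simp add: UNIV_bool add.commute)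
qed

text \<open>Index \<open>i0\<close> receives minus the weighted sum. In a decomposition without loss
  of norm, every piece at \<open>i \<noteq> i0\<close> is a multiple of \<open>e i\<close>; a
  nonzero exchange between two such indices would make \<open>e i\<close> and \<open>- e j\<close>
  equal. All weight therefore passes through \<open>i0\<close>.\<close>

lemma dual_norm_extreme_sum_aux:
  fixes e :: "'n::finite \<Rightarrow> real ^ 'n"
  assumes N: "is_norm N" and P: "lowdim_diameter_property N"
    and e: "\<And>i. i \<noteq> i0 \<Longrightarrow> e i extreme_point_of unit_ball (dual_norm N)"
    and anti: "\<And>i j. i \<noteq> i0 \<Longrightarrow> j \<noteq> i0 \<Longrightarrow> e i \<noteq> - e j"
    and a: "\<And>i. i \<noteq> i0 \<Longrightarrow> 0 \<le> a i"
  shows "dual_norm N (\<Sum>i\<in>-{i0}. a i *\<^sub>R e i) = (\<Sum>i\<in>-{i0}. a i)"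
proof -
  note D = is_norm_dual_norm[OF N]
  let ?D = "dual_norm N"
  define v where "v = (\<Sum>i\<in>-{i0}. a i *\<^sub>R e i)"
  define f where "f i = (if i = i0 then - v else a i *\<^sub>R e i)" for i
  have "(\<Sum>i\<in>UNIV. f i) = f i0 + (\<Sum>i\<in>-{i0}. f i)"
    by (subst sum.remove[of _ i0]) (auto simp: Compl_eq_Diff_UNIV)
  also have "(\<Sum>i\<in>-{i0}. f i) = v"
    unfolding v_def by (intro sum.cong) (auto simp: f_def)
  finally have "(\<Sum>i\<in>UNIV. f i) = 0" by (simp add: f_def)
  then obtain g where g: "\<And>i. f i = (\<Sum>j\<in>UNIV. g i j - g j i)"
    "\<And>i. ?D (f i) = (\<Sum>j\<in>UNIV. ?D (g i j) + ?D (g j i))"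
    using zero_sum_decomposition[OF N P \<open>(\<Sum>i\<in>UNIV. f i) = 0\<close>] by blast
  have Df: "?D (f i) = a i" if "i \<noteq> i0" for i
    using that a extreme_point_norm_eq_1[OF D e] by (simp add: f_def is_norm_scaleR[OF D])
  have multiple: "g i j = ?D (g i j) *\<^sub>R e i \<and> - g j i = ?D (g j i) *\<^sub>R e i" if "i \<noteq> i0" for i j
  proof -
    \<comment> \<open>Negating the pieces of one direction keeps their norms and writes
      \<open>f i\<close> as an ordinary sum.\<close>
    define h where "h = (\<lambda>(k, b). if b then g i k else - g k i)"
    have "h x = ?D (h x) *\<^sub>R e i" for x
    proof (rule extreme_point_summand_sum[OF D e[OF that], where h = h and A = UNIV and a = "a i"])
      show "sum h UNIV = a i *\<^sub>R e i"
        using g(1)[of i] that by (simp add: sum_UNIV_bool_prod h_def f_def)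
      show "(\<Sum>x\<in>UNIV. ?D (h x)) \<le> a i"
        using g(2)[of i] Df[OF that] by (simp add: sum_UNIV_bool_prod h_def is_norm_minus[OF D])
    qed auto
    from this[of "(j, True)"] this[of "(j, False)"] show ?thesis
      by (simp add: h_def is_norm_minus[OF D])
  qed
  have zero: "?D (g i j) = 0" if "i \<noteq> i0" "j \<noteq> i0" for i j
  proof (rule ccontr)
    assume nz: "?D (g i j) \<noteq> 0"
    have "?D (g i j) *\<^sub>R e i = ?D (g i j) *\<^sub>R (- e j)"
      using multiple[OF that(1), of j] multiple[OF that(2), of i]
      by (metis minus_minus scaleR_minus_right)
    then have "e i = - e j" by (rule scaleR_left_imp_eq[OF nz])
    with anti[OF that] show False by simp
  qed
  have "a i = ?D (g i i0) + ?D (g i0 i)" if "i \<noteq> i0" for i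
  proof -
    have "a i = (\<Sum>j\<in>UNIV. ?D (g i j) + ?D (g j i))"
      using g(2)[of i] Df[OF that] by simp
    also have "\<dots> = (\<Sum>j\<in>{i0}. ?D (g i j) + ?D (g j i))"
      using zero that by (intro sum.mono_neutral_right) auto
    finally show ?thesis by simp
  qed
  then have "(\<Sum>i\<in>-{i0}. a i) = (\<Sum>i\<in>-{i0}. ?D (g i0 i) + ?D (g i i0))"
    by (intro sum.cong) auto
  also have "\<dots> \<le> (\<Sum>i\<in>UNIV. ?D (g i0 i) + ?D (g i i0))"
    by (intro sum_mono2) (auto intro!: add_nonneg_nonneg is_norm_nonneg[OF D])
  also have "\<dots> = ?D v"
    using g(2)[of i0] by (simp add: f_def is_norm_minus[OF D])
  finally have "(\<Sum>i\<in>-{i0}. a i) \<le> ?D v" .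
  moreover have "?D v \<le> (\<Sum>i\<in>-{i0}. ?D (a i *\<^sub>R e i))"
    unfolding v_def by (rule is_norm_sum[OF D])
  moreover have "\<dots> = (\<Sum>i\<in>-{i0}. a i)"
    using Df by (intro sum.cong) (auto simp: f_def)
  ultimately show ?thesis by (simp add: v_def)
qed

text \<open>An index set with fewer than \<open>n\<close> elements embeds in the complement of a
  single index \<open>i0\<close>.\<close>

lemma dual_norm_extreme_sum:
  fixes e :: "'i \<Rightarrow> real ^ 'n"
  assumes N: "is_norm N" and P: "lowdim_diameter_property N"
    and I: "finite I" "card I < CARD('n)"
    and e: "\<And>i. i \<in> I \<Longrightarrow> e i extreme_point_of unit_ball (dual_norm N)"
    and anti: "\<And>i j. i \<in> I \<Longrightarrow> j \<in> I \<Longrightarrow> e i \<noteq> - e j"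
    and a: "\<And>i. i \<in> I \<Longrightarrow> 0 \<le> a i"
  shows "dual_norm N (\<Sum>i\<in>I. a i *\<^sub>R e i) = (\<Sum>i\<in>I. a i)"
proof (cases "I = {}")
  case True
  then show ?thesis by (simp add: is_norm_zero[OF is_norm_dual_norm[OF N]])
next
  case False
  then obtain k where k: "k \<in> I" by blast
  define i0 :: 'n where "i0 = undefined"
  have "card I \<le> card (-{i0})" using I by (simp add: Compl_eq_Diff_UNIV card_Diff_singleton)
  then obtain \<phi> where \<phi>: "\<phi> ` I \<subseteq> -{i0}" "inj_on \<phi> I"
    using card_le_inj[OF I(1), of "-{i0}"] by auto
  \<comment> \<open>Indices outside the image of \<open>\<phi>\<close> receive the extreme point of
    some fixed \<open>k\<close> with coefficient 0, so the sums do not change.\<close>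
  define \<psi> where "\<psi> j = (if j \<in> \<phi> ` I then inv_into I \<phi> j else k)" for j
  define c where "c j = (if j \<in> \<phi> ` I then a (\<psi> j) else 0)" for j
  have \<psi>: "\<psi> j \<in> I" for j using k by (auto simp: \<psi>_def inv_into_into)
  have \<psi>\<phi>: "\<psi> (\<phi> i) = i" if "i \<in> I" for i using that \<phi>(2) by (simp add: \<psi>_def)
  have "dual_norm N (\<Sum>j\<in>-{i0}. c j *\<^sub>R e (\<psi> j)) = (\<Sum>j\<in>-{i0}. c j)"
    using \<psi> by (intro dual_norm_extreme_sum_aux[OF N P] e anti) (auto simp: c_def intro: a)
  also have "(\<Sum>j\<in>-{i0}. c j) = (\<Sum>j\<in>\<phi> ` I. c j)"
    using \<phi>(1) by (intro sum.mono_neutral_right) (auto simp: c_def)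
  also have "\<dots> = (\<Sum>i\<in>I. a i)"
    by (subst sum.reindex[OF \<phi>(2)]) (auto simp: c_def \<psi>\<phi> intro!: sum.cong)
  also have "(\<Sum>j\<in>-{i0}. c j *\<^sub>R e (\<psi> j)) = (\<Sum>j\<in>\<phi> ` I. c j *\<^sub>R e (\<psi> j))"
    using \<phi>(1) by (intro sum.mono_neutral_right) (auto simp: c_def)
  also have "\<dots> = (\<Sum>i\<in>I. a i *\<^sub>R e i)"
    by (subst sum.reindex[OF \<phi>(2)]) (auto simp: c_def \<psi>\<phi> intro!: sum.cong)
  finally show ?thesis .
qed

lemma extreme_point_unit_ball_minus:
  assumes D: "is_norm D" and e: "e extreme_point_of unit_ball D"
  shows "- e extreme_point_of unit_ball D"
proof -
  have "- e \<notin> open_segment a b" if "a \<in> unit_ball D" "b \<in> unit_ball D" for a b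
  proof
    assume "- e \<in> open_segment a b"
    then obtain u where "a \<noteq> b" "0 < u" "u < 1" "- e = (1 - u) *\<^sub>R a + u *\<^sub>R b"
      unfolding in_segment by blast
    then have "e \<in> open_segment (- a) (- b)"
      unfolding in_segment by (auto intro!: exI[of _ u] simp: minus_equation_iff[of e])
    with that e show False by (simp add: extreme_point_of_def unit_ball_def is_norm_minus[OF D])
  qed
  with e show ?thesis by (simp add: extreme_point_of_def unit_ball_def is_norm_minus[OF D])
qed

text \<open>Any two of the \<open>n + 1\<close> terms of \<open>- e + (\<Sum>i. c i *\<^sub>R b i) = 0\<close> and the \<open>n - 1\<close> remaining ones
  both have additive dual norm, so every pair carries half of the total weight.\<close>

lemma extreme_point_coefficients:
  fixes b :: "'n::finite \<Rightarrow> real ^ 'n"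
  assumes N: "is_norm N" and P: "lowdim_diameter_property N" and n: "CARD('n) \<ge> 3"
    and b: "\<And>i. b i extreme_point_of unit_ball (dual_norm N)"
    and anti: "\<And>i j. i \<noteq> j \<Longrightarrow> b i \<noteq> b j \<and> b i \<noteq> - b j"
    and e: "e extreme_point_of unit_ball (dual_norm N)"
    and eb: "\<And>i. e \<noteq> b i \<and> e \<noteq> - b i"
    and c: "e = (\<Sum>i\<in>UNIV. c i *\<^sub>R b i)"
  shows "CARD('n) = 3" "\<bar>c i\<bar> = 1"
proof -
  note D = is_norm_dual_norm[OF N]
  let ?D = "dual_norm N"
  \<comment> \<open>Signs are moved into the extreme points to make all weights nonnegative;
    \<open>None\<close> stands for \<open>- e\<close> with weight 1.\<close>
  define u where "u x = (case x of None \<Rightarrow> - e | Some i \<Rightarrow> (if c i < 0 then - b i else b i))" for x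
  define a where "a x = (case x of None \<Rightarrow> 1 | Some i \<Rightarrow> \<bar>c i\<bar>)" for x
  define S where "S = (\<Sum>x\<in>UNIV. a x)"
  have u_ext: "u x extreme_point_of unit_ball ?D" for x
    using b e by (auto simp: u_def extreme_point_unit_ball_minus[OF D] split: option.splits)
  have u_anti: "u x \<noteq> - u y" for x y
  proof (cases "x = y")
    case True
    then show ?thesis using extreme_point_neq_minus[OF D u_ext] by simp
  next
    case False
    have neg: "v \<noteq> - w \<and> v \<noteq> w \<and> - v \<noteq> w" if "v \<noteq> w \<and> v \<noteq> - w" for v w :: "real ^ 'n"
      using that by auto
    show ?thesis
    proof (cases x; cases y)
      fix i j assume "x = Some i" "y = Some j"
      with False neg[of "b i" "b j"] anti[of i j] show ?thesis by (auto simp: u_def)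
    next
      fix i assume "x = Some i" "y = None"
      with neg[OF eb[of i]] show ?thesis by (auto simp: u_def)
    next
      fix i assume "x = None" "y = Some i"
      with neg[OF eb[of i]] show ?thesis by (auto simp: u_def)
    qed (use False in auto)
  qed
  have a0: "0 \<le> a x" for x by (simp add: a_def split: option.splits)
  have "(\<Sum>x\<in>UNIV. a x *\<^sub>R u x) = - e + (\<Sum>i\<in>UNIV. c i *\<^sub>R b i)"
    unfolding UNIV_option_conv
    by (subst sum.insert) (auto simp: sum.reindex a_def u_def intro!: sum.cong)
  then have sum0: "(\<Sum>x\<in>UNIV. a x *\<^sub>R u x) = 0" using c by simp
  have add: "?D (\<Sum>x\<in>I. a x *\<^sub>R u x) = (\<Sum>x\<in>I. a x)" if "card I < CARD('n)" for I
    using that a0 u_ext u_anti by (intro dual_norm_extreme_sum[OF N P]) auto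
  have pair: "2 * (a x + a y) = S" if "x \<noteq> y" for x y
  proof -
    have "(\<Sum>x\<in>-{x, y}. a x *\<^sub>R u x) = - (\<Sum>x\<in>{x, y}. a x *\<^sub>R u x)"
      using sum0 sum.subset_diff[of "{x, y}" UNIV "\<lambda>x. a x *\<^sub>R u x"]
      by (simp add: Compl_eq_Diff_UNIV eq_neg_iff_add_eq_0)
    then have "?D (\<Sum>x\<in>-{x, y}. a x *\<^sub>R u x) = ?D (\<Sum>x\<in>{x, y}. a x *\<^sub>R u x)"
      by (simp only: is_norm_minus[OF D])
    \<comment> \<open>Of the \<open>n + 1\<close> indices the complement keeps \<open>n - 1\<close>;
      the pair has 2, which is below \<open>n\<close> because \<open>n \<ge> 3\<close>.\<close>
    moreover have "card (-{x, y}) < CARD('n)" "card {x, y} < CARD('n)"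
      using n that by (simp_all add: Compl_eq_Diff_UNIV card_Diff_subset)
    ultimately have "(\<Sum>x\<in>-{x, y}. a x) = (\<Sum>x\<in>{x, y}. a x)"
      using add[of "-{x, y}"] add[of "{x, y}"] by simp
    then show ?thesis
      using that sum.subset_diff[of "{x, y}" UNIV a] by (simp add: S_def Compl_eq_Diff_UNIV)
  qed
  have eq: "a x = 1" for x
  proof (cases "x = None")
    case False
    \<comment> \<open>A third index \<open>z\<close> lets the pairs \<open>{x, z}\<close> and
      \<open>{None, z}\<close> be compared, so every weight equals that of \<open>None\<close>,
      which is 1.\<close>
    have "card {x, None} < card (UNIV :: 'n option set)"
      using n False by simp
    then have "{x, None} \<noteq> UNIV" by force
    then obtain z where "z \<noteq> x" "z \<noteq> None" by blast
    with pair[of x z] pair[of None z] have "a x = a None" by simp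
    then show ?thesis by (simp add: a_def)
  qed (simp add: a_def)
  then show "\<bar>c i\<bar> = 1" using a_def[of "Some i"] by simp
  \<comment> \<open>The total weight is \<open>n + 1\<close> by counting and 4 by the pair
    condition.\<close>
  have "S = real (CARD('n) + 1)" using eq by (simp add: S_def)
  moreover have "S = 4" using pair[of None "Some undefined"] eq by simp
  ultimately show "CARD('n) = 3" by linarith
qed

section \<open>Bases of extreme points\<close>

lemma eq_0_if_inner_extreme_points_eq_0:
  assumes N: "is_norm N"
    and x: "\<And>e. e extreme_point_of unit_ball (dual_norm N) \<Longrightarrow> e \<bullet> x = 0"
  shows "x = 0"
proof (rule ccontr)
  assume "x \<noteq> 0"
  then have "N x > 0" using is_norm_nonneg[OF N, of x] is_norm_eq_0[OF N, of x] by linarith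
  \<comment> \<open>A multiple of \<open>x\<close> of norm 2 would satisfy all inequalities that
    describe the unit ball.\<close>
  moreover have "N ((2 / N x) *\<^sub>R x) \<le> 1"
    unfolding norm_le_iff_extreme[OF N] using x by simp
  ultimately show False by (simp add: is_norm_scaleR[OF N])
qed

text \<open>The extreme points span because a vector orthogonal to all of them vanishes. Indexing a
  basis by \<open>'n\<close> makes its members the rows of an invertible matrix.\<close>

lemma extreme_point_basis:
  fixes N :: "real ^ 'n \<Rightarrow> real"
  assumes N: "is_norm N"
  obtains b :: "'n \<Rightarrow> real ^ 'n" where
    "\<And>i. b i extreme_point_of unit_ball (dual_norm N)" "span (range b) = UNIV" "inj b"
    "invertible (\<chi> i. b i)"
proof -
  define E where "E = {e. e extreme_point_of unit_ball (dual_norm N)}"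
  have E: "span E = UNIV"
  proof (rule ccontr)
    assume "span E \<noteq> UNIV"
    then obtain a where "a \<noteq> 0" "\<forall>x\<in>span E. a \<bullet> x = 0"
      using span_not_UNIV_orthogonal by blast
    then show False
      using eq_0_if_inner_extreme_points_eq_0[OF N, of a]
      by (simp add: E_def inner_commute span_base)
  qed
  obtain B where B: "B \<subseteq> E" "independent B" "E \<subseteq> span B" "card B = dim E"
    using basis_exists[of E] by blast
  have "dim E = CARD('n)" using E dim_span[of E] by (simp add: dim_UNIV)
  have "finite B" using B(2) by (rule independent_imp_finite)
  then obtain b :: "'n \<Rightarrow> real ^ 'n" where b: "bij_betw b UNIV B"
    using finite_same_card_bij[of "UNIV :: 'n set" B] B(4) \<open>dim E = CARD('n)\<close> by auto
  then have range: "range b = B" "inj b" by (auto simp: bij_betw_def)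
  have span: "span (range b) = UNIV"
    using B(3) E span_mono[of E "span B"] by (auto simp: range span_span)
  have "invertible (\<chi> i. b i)"
    unfolding invertible_left_inverse matrix_left_invertible_ker
  proof (intro allI impI)
    fix x assume 0: "(\<chi> i. b i) *v x = 0"
    have "b i \<bullet> x = 0" for i
      using arg_cong[OF 0, of "\<lambda>v. v $ i"] by (simp add: matrix_vector_mul_component)
    then have "orthogonal x v" if "v \<in> range b" for v
      using that by (auto simp: orthogonal_def inner_commute)
    then have "orthogonal x x"
      using orthogonal_to_span[of x "range b" x] span by blast
    then show "x = 0" by (simp add: orthogonal_def)
  qed
  with that[of b] span range(2) B(1) range(1) show ?thesis by (auto simp: E_def)
qed

section \<open>The shape of the unit ball\<close>

text \<open>Turns balls described by inequalities in \<open>M *v x\<close> into affine images, the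
  form in which parallelotopes and cross-polytopes are defined.\<close>

lemma vimage_matrix_eq_affine_image:
  fixes M :: "real ^ 'n ^ 'n"
  assumes "invertible M"
  shows "\<exists>f. nonsingular_affine_map f \<and> (\<forall>P. {x. P (M *v x)} = f ` {y. P y})"
proof -
  obtain M' where M': "M ** M' = mat 1" "M' ** M = mat 1" using assms by (auto simp: invertible_def)
  then have "nonsingular_affine_map (\<lambda>x. M' *v x + 0)"
    unfolding nonsingular_affine_map_def invertible_def by blast
  moreover have 1: "M *v (M' *v x) = x" "M' *v (M *v x) = x" for x
    using M' by (simp_all add: matrix_vector_mul_assoc)
  have "{x. P (M *v x)} = (\<lambda>x. M' *v x + 0) ` {y. P y}" for P
    using 1 by (force simp: image_iff)
  ultimately show ?thesis by blast
qed

section \<open>The standard cross-polytope as the unit ball of the sum norm\<close>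

lemma is_norm_l1: "is_norm (\<lambda>x :: real ^ 'n. \<Sum>i\<in>UNIV. \<bar>x $ i\<bar>)"
  unfolding is_norm_def
proof (intro conjI allI)
  fix x y :: "real ^ 'n"
  show "(\<Sum>i\<in>UNIV. \<bar>(x + y) $ i\<bar>) \<le> (\<Sum>i\<in>UNIV. \<bar>x $ i\<bar>) + (\<Sum>i\<in>UNIV. \<bar>y $ i\<bar>)"
    unfolding sum.distrib[symmetric] by (intro sum_mono) (simp add: abs_triangle_ineq)
qed (auto intro: sum_nonneg simp: sum_nonneg_eq_0_iff vec_eq_iff sum_distrib_left abs_mult)

lemma convex_hull_axes:
  "convex hull (\<Union>i. {axis i 1, - axis i 1}) = {x :: real ^ 'n. (\<Sum>i\<in>UNIV. \<bar>x $ i\<bar>) \<le> 1}"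
    (is "?H = ?B")
proof
  have *: "(\<Sum>j\<in>UNIV. \<bar>axis i (1::real) $ j\<bar>) = 1" for i :: 'n
    by (simp add: axis_def if_distrib cong: if_cong)
  have "convex ?B" using convex_unit_ball[OF is_norm_l1] by (simp add: unit_ball_def)
  then show "?H \<subseteq> ?B" by (intro hull_minimal) (auto simp: *)
  show "?B \<subseteq> ?H"
  proof
    fix x assume "x \<in> ?B"
    \<comment> \<open>The weights \<open>\<bar>x $ i\<bar>\<close> go to signed axis vectors, and
      \<open>None\<close> puts the remaining weight on the origin.\<close>
    define w where "w k = (case k of None \<Rightarrow> 1 - (\<Sum>i\<in>UNIV. \<bar>x $ i\<bar>) | Some i \<Rightarrow> \<bar>x $ i\<bar>)" for k
    define y :: "'n option \<Rightarrow> real ^ 'n" where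
      "y k = (case k of None \<Rightarrow> 0 | Some i \<Rightarrow> (if x $ i < 0 then - axis i 1 else axis i 1))" for k
    have mem: "axis i 1 \<in> ?H" "- axis i 1 \<in> ?H" for i by (auto intro: hull_inc)
    have "0 \<in> ?H"
      using convexD[OF convex_convex_hull mem(1)[of undefined] mem(2)[of undefined], of "1/2" "1/2"] by simp
    then have "y k \<in> ?H" for k
      using mem by (simp add: y_def split: option.splits)
    then have "(\<Sum>k\<in>UNIV. w k *\<^sub>R y k) \<in> ?H"
      using \<open>x \<in> ?B\<close>
      by (intro convex_sum) (auto simp: w_def UNIV_option_conv sum.reindex split: option.splits)
    also have "(\<Sum>k\<in>UNIV. w k *\<^sub>R y k) = (\<Sum>i\<in>UNIV. \<bar>x $ i\<bar> *\<^sub>R (if x $ i < 0 then - axis i 1 else axis i 1))"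
      by (simp add: UNIV_option_conv sum.reindex w_def y_def)
    also have "\<dots> = (\<Sum>i\<in>UNIV. x $ i *\<^sub>R axis i 1)" by (intro sum.cong) auto
    also have "\<dots> = x"
      by (simp add: vec_eq_iff axis_def if_distrib cong: if_cong)
    finally show "x \<in> ?H" .
  qed
qed

text \<open>The extreme points say that the ball is the preimage of the cube under the matrix with
  rows \<open>b i\<close>.\<close>

lemma parallelotope_if_extreme_points:
  fixes N :: "real ^ 'n \<Rightarrow> real" and b :: "'n \<Rightarrow> real ^ 'n"
  assumes N: "is_norm N" and inv: "invertible (\<chi> i. b i)"
    and b: "\<And>i. b i extreme_point_of unit_ball (dual_norm N)"
    and E: "\<And>e. e extreme_point_of unit_ball (dual_norm N) \<Longrightarrow> \<exists>i. e = b i \<or> e = - b i"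
  shows "parallelotope (unit_ball N)"
proof -
  have minus: "- b i extreme_point_of unit_ball (dual_norm N)" for i
    by (rule extreme_point_unit_ball_minus[OF is_norm_dual_norm[OF N] b])
  have "N x \<le> 1 \<longleftrightarrow> (\<forall>i. - 1 \<le> b i \<bullet> x \<and> b i \<bullet> x \<le> 1)" for x
    unfolding norm_le_iff_extreme[OF N]
  proof safe
    fix i assume "\<forall>e. e extreme_point_of unit_ball (dual_norm N) \<longrightarrow> e \<bullet> x \<le> 1"
    with b[of i] minus[of i] show "- 1 \<le> b i \<bullet> x" "b i \<bullet> x \<le> 1" by force+
  next
    fix e assume 1: "\<forall>i. - 1 \<le> b i \<bullet> x \<and> b i \<bullet> x \<le> 1"
      and "e extreme_point_of unit_ball (dual_norm N)"
    then obtain i where "e = b i \<or> e = - b i" using E by blast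
    with 1[rule_format, of i] show "e \<bullet> x \<le> 1" by auto
  qed
  then have "unit_ball N = {x. \<forall>i. - 1 \<le> ((\<chi> i. b i) *v x) $ i \<and> ((\<chi> i. b i) *v x) $ i \<le> 1}"
    by (simp add: unit_ball_def matrix_vector_mul_component)
  moreover obtain f where "nonsingular_affine_map f" "\<And>P. {x. P ((\<chi> i. b i) *v x)} = f ` {y. P y}"
    using vimage_matrix_eq_affine_image[OF inv] by blast
  ultimately show ?thesis
    unfolding parallelotope_def by (intro exI[of _ f] conjI) simp_all
qed

lemma sum_UNIV_three:
  assumes "UNIV = {i, j, k}" "i \<noteq> j" "j \<noteq> k" "i \<noteq> k"
  shows "(\<Sum>l\<in>UNIV. f l) = f i + (f j + f k)"
  unfolding assms(1) using assms(2-) by simp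

text \<open>Up to sign, the eight facet functionals of the octahedron are the coordinate sum and the
  three obtained from it by flipping one sign, \<open>s - 2 * z $ i\<close>.\<close>

lemma l1_ball_three:
  fixes z :: "real ^ 'n"
  assumes "CARD('n) = 3" and s: "s = (\<Sum>i\<in>UNIV. z $ i)"
  shows "(\<Sum>i\<in>UNIV. \<bar>z $ i\<bar>) \<le> 1 \<longleftrightarrow> \<bar>s\<bar> \<le> 1 \<and> (\<forall>i. \<bar>s - 2 * z $ i\<bar> \<le> 1)"
proof -
  obtain i j k :: 'n where ijk: "UNIV = {i, j, k}" "i \<noteq> j" "j \<noteq> k" "i \<noteq> k"
    using assms(1) by (metis card_3_iff)
  then have all: "(\<forall>l. P l) \<longleftrightarrow> P i \<and> P j \<and> P k" for P by (metis UNIV_I insertE singletonD)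
  have s': "s = z $ i + z $ j + z $ k" "(\<Sum>i\<in>UNIV. \<bar>z $ i\<bar>) = \<bar>z $ i\<bar> + \<bar>z $ j\<bar> + \<bar>z $ k\<bar>"
    unfolding s by (simp_all add: sum_UNIV_three[OF ijk])
  show ?thesis unfolding all s' by (auto simp: abs_if split: if_splits)
qed

text \<open>In the coordinates given by \<open>M\<close>, the four functionals \<open>b i\<close>
  and their sum become the facet functionals of the octahedron.\<close>

lemma cross_polytope_if_extreme_points:
  fixes N :: "real ^ 'n \<Rightarrow> real" and b :: "'n \<Rightarrow> real ^ 'n"
  assumes N: "is_norm N" and n: "CARD('n) = 3"
    and b: "\<And>i. b i extreme_point_of unit_ball (dual_norm N)"
    and e: "(\<Sum>i\<in>UNIV. b i) extreme_point_of unit_ball (dual_norm N)"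
    and E: "\<And>u. u extreme_point_of unit_ball (dual_norm N) \<Longrightarrow>
      (\<exists>i. u = b i \<or> u = - b i) \<or> u = (\<Sum>i\<in>UNIV. b i) \<or> u = - (\<Sum>i\<in>UNIV. b i)"
  shows "cross_polytope (unit_ball N)"
proof -
  define s where "s = (\<Sum>i\<in>UNIV. b i)"
  \<comment> \<open>Row \<open>i\<close> is the solution y of s - 2y = \<open>b i\<close>; the three
    rows add up to (3s - s)/2 = s.\<close>
  define M :: "real ^ 'n ^ 'n" where "M = (\<chi> i. (1 / 2) *\<^sub>R (s - b i))"
  have M: "(M *v x) $ i = (s \<bullet> x - b i \<bullet> x) / 2" for x i
    by (simp add: M_def matrix_vector_mul_component inner_diff_left)
  have sum_M: "(\<Sum>i\<in>UNIV. (M *v x) $ i) = s \<bullet> x" for x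
  proof -
    have "(\<Sum>i\<in>UNIV. (M *v x) $ i) = (3 * (s \<bullet> x) - s \<bullet> x) / 2"
      unfolding M sum_divide_distrib[symmetric] sum_subtractf
      by (simp add: n s_def inner_sum_left)
    then show ?thesis by simp
  qed
  have minus: "- u extreme_point_of unit_ball (dual_norm N)"
    if "u extreme_point_of unit_ball (dual_norm N)" for u
    by (rule extreme_point_unit_ball_minus[OF is_norm_dual_norm[OF N] that])
  have ball: "N x \<le> 1 \<longleftrightarrow> \<bar>s \<bullet> x\<bar> \<le> 1 \<and> (\<forall>i. \<bar>b i \<bullet> x\<bar> \<le> 1)" for x
    unfolding norm_le_iff_extreme[OF N]
  proof (intro iffI conjI allI impI)
    assume *: "\<forall>e. e extreme_point_of unit_ball (dual_norm N) \<longrightarrow> e \<bullet> x \<le> 1"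
    show "\<bar>s \<bullet> x\<bar> \<le> 1" using *[rule_format, OF e] *[rule_format, OF minus[OF e]]
      by (simp add: s_def abs_le_iff)
    show "\<bar>b i \<bullet> x\<bar> \<le> 1" for i
      using *[rule_format, OF b] *[rule_format, OF minus[OF b]] by (simp add: abs_le_iff)
  next
    fix u assume *: "\<bar>s \<bullet> x\<bar> \<le> 1 \<and> (\<forall>i. \<bar>b i \<bullet> x\<bar> \<le> 1)"
      and "u extreme_point_of unit_ball (dual_norm N)"
    then have "(\<exists>i. u = b i \<or> u = - b i) \<or> u = s \<or> u = - s" using E by (simp add: s_def)
    with * show "u \<bullet> x \<le> 1" by (auto simp: abs_le_iff)
  qed
  have "invertible M"
    unfolding invertible_left_inverse matrix_left_invertible_ker
  proof (intro allI impI)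
    fix x assume "M *v x = 0"
    then have "s \<bullet> x = 0" "b i \<bullet> x = 0" for i
      using sum_M[of x] M[of x i] by simp_all
    then have "u \<bullet> x = 0" if "u extreme_point_of unit_ball (dual_norm N)" for u
      using E[OF that] by (auto simp: s_def)
    then show "x = 0" by (rule eq_0_if_inner_extreme_points_eq_0[OF N])
  qed
  obtain f where "nonsingular_affine_map f" "\<And>P. {x. P (M *v x)} = f ` {y. P y}"
    using vimage_matrix_eq_affine_image[OF \<open>invertible M\<close>] by blast
  moreover have "s \<bullet> x - 2 * (M *v x) $ i = b i \<bullet> x" for x i
    by (simp add: M field_simps)
  then have "unit_ball N = {x. (\<Sum>i\<in>UNIV. \<bar>(M *v x) $ i\<bar>) \<le> 1}"
    unfolding unit_ball_def ball l1_ball_three[OF n refl] sum_M by simp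
  ultimately show ?thesis
    unfolding cross_polytope_def convex_hull_axes by (intro exI[of _ f] conjI) simp_all
qed

text \<open>Two extreme points are fewer than \<open>n\<close>, so the weights 1 and 2 add and the
  right-hand side has dual norm 3, while \<open>w\<close> has dual norm 1.\<close>

lemma extreme_point_not_add_double:
  fixes u v w :: "real ^ 'n"
  assumes N: "is_norm N" and P: "lowdim_diameter_property N" and n: "CARD('n) \<ge> 3"
    and ext: "u extreme_point_of unit_ball (dual_norm N)" "v extreme_point_of unit_ball (dual_norm N)"
      "w extreme_point_of unit_ball (dual_norm N)"
    and "u \<noteq> - v"
  shows "w \<noteq> u + 2 *\<^sub>R v"
proof
  assume w: "w = u + 2 *\<^sub>R v"
  note D = is_norm_dual_norm[OF N]
  have "dual_norm N (\<Sum>i\<in>UNIV. (if i then 1 else 2) *\<^sub>R (if i then u else v)) = (\<Sum>i\<in>UNIV. if i then 1 else 2)"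
  proof (intro dual_norm_extreme_sum[OF N P])
    have "v \<noteq> - u" using \<open>u \<noteq> - v\<close> by (metis minus_minus)
    then show "(if i then u else v) \<noteq> - (if j then u else v)" for i j
      using extreme_point_neq_minus[OF D ext(1)] extreme_point_neq_minus[OF D ext(2)] \<open>u \<noteq> - v\<close> by simp
  qed (use n ext in auto)
  then have "dual_norm N w = 3" by (simp add: UNIV_bool w add.commute)
  with extreme_point_norm_eq_1[OF D ext(3)] show False by simp
qed

lemma lowdim_diameter_property_imp_shape:
  fixes N :: "real ^ 'n \<Rightarrow> real"
  assumes N: "is_norm N" and P: "lowdim_diameter_property N" and n: "CARD('n) \<ge> 3"
  shows "parallelotope (unit_ball N) \<or> CARD('n) = 3 \<and> cross_polytope (unit_ball N)"
proof -
  note D = is_norm_dual_norm[OF N]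
  define ext where "ext u \<longleftrightarrow> u extreme_point_of unit_ball (dual_norm N)" for u
  obtain b :: "'n \<Rightarrow> real ^ 'n" where b: "\<And>i. ext (b i)"
    and span: "span (range b) = UNIV" and inj: "inj b" and inv: "invertible (\<chi> i. b i)"
    using extreme_point_basis[OF N] unfolding ext_def by blast
  have minus: "ext (- u)" if "ext u" for u
    using extreme_point_unit_ball_minus[OF D] that by (simp add: ext_def)
  \<comment> \<open>The columns of the inverse form the dual basis, which tells \<open>b i\<close>
    apart from \<open>b j\<close> and \<open>- b j\<close>.\<close>
  obtain M' where M': "(\<chi> i. b i) ** M' = mat 1" using inv by (auto simp: invertible_def)
  have dual: "b k \<bullet> (M' *v axis i 1) = (if k = i then 1 else 0)" for i k
  proof -
    have "(\<chi> i. b i) *v (M' *v axis i 1) = axis i 1"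
      using M' by (simp add: matrix_vector_mul_assoc)
    then have "((\<chi> i. b i) *v (M' *v axis i 1)) $ k = axis i 1 $ k" by simp
    then show ?thesis by (simp add: matrix_vector_mul_component axis_def)
  qed
  have anti: "b i \<noteq> b j \<and> b i \<noteq> - b j" if "i \<noteq> j" for i j
    using dual[of i i] dual[of j i] that by auto
  have coeffs: "\<exists>c. u = (\<Sum>i\<in>UNIV. c i *\<^sub>R b i)" for u
  proof -
    have "u \<in> range (\<lambda>c. \<Sum>v\<in>range b. c v *\<^sub>R v)"
      using span span_finite[of "range b"] by auto
    then show ?thesis using inj by (auto simp: sum.reindex)
  qed
  show ?thesis
  proof (cases "\<forall>e. ext e \<longrightarrow> (\<exists>i. e = b i \<or> e = - b i)")
    case True
    then show ?thesis
      using parallelotope_if_extreme_points[OF N inv] b by (simp add: ext_def)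
  next
    case False
    then obtain e where e: "ext e" "\<And>i. e \<noteq> b i \<and> e \<noteq> - b i" by blast
    obtain c where c: "e = (\<Sum>i\<in>UNIV. c i *\<^sub>R b i)" using coeffs by blast
    note coef = extreme_point_coefficients[OF N P n b[unfolded ext_def] anti e(1)[unfolded ext_def] e(2) c]
    \<comment> \<open>Absorbing the signs \<open>c i\<close> makes \<open>e\<close> the plain sum of
      the \<open>b' i\<close>.\<close>
    define b' where "b' i = c i *\<^sub>R b i" for i
    have c1: "c i = 1 \<or> c i = - 1" for i using coef(2)[of i] by linarith
    have b': "b' i = b i \<or> b' i = - b i" for i using c1[of i] by (auto simp: b'_def)
    have ext_b': "ext (b' i)" for i using b'[of i] b[of i] minus by auto
    have eb': "(\<Sum>i\<in>UNIV. b' i) = e" by (simp add: c b'_def)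
    have "(\<exists>i. u = b' i \<or> u = - b' i) \<or> u = e \<or> u = - e" if u: "ext u" for u
    proof (rule ccontr)
      assume *: "\<not> ?thesis"
      then have u_b': "u \<noteq> b' i \<and> u \<noteq> - b' i" for i by blast
      then have u_b: "u \<noteq> b i \<and> u \<noteq> - b i" for i using b'[of i] by (metis minus_minus)
      obtain d where d: "u = (\<Sum>i\<in>UNIV. d i *\<^sub>R b i)" using coeffs by blast
      note coef_u = extreme_point_coefficients(2)[OF N P n b[unfolded ext_def] anti
          u[unfolded ext_def] u_b d]
      define r where "r i = d i * c i" for i
      have r: "r i = 1 \<or> r i = - 1" for i
        using coef_u[of i] coef(2)[of i] by (auto simp: r_def abs_if split: if_splits)
      have "r i *\<^sub>R b' i = d i *\<^sub>R b i" for i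
        using c1[of i] by (auto simp: r_def b'_def)
      then have ur: "u = (\<Sum>i\<in>UNIV. r i *\<^sub>R b' i)" by (simp add: d)
      obtain i j k :: 'n where ijk: "UNIV = {i, j, k}" "i \<noteq> j" "j \<noteq> k" "i \<noteq> k"
        using coef(1) by (metis card_3_iff)
      have u3: "u = r i *\<^sub>R b' i + r j *\<^sub>R b' j + r k *\<^sub>R b' k"
        unfolding ur sum_UNIV_three[OF ijk] by (simp add: add.assoc)
      have e3: "e = b' i + b' j + b' k"
        unfolding eb'[symmetric] sum_UNIV_three[OF ijk] by (simp add: add.assoc)
      \<comment> \<open>Unless \<open>u\<close> is \<open>e\<close> or \<open>- e\<close>, its sign
        pattern has, up to a global sign, exactly one minus, at some \<open>l\<close>; then
        \<open>e = u + 2 *\<^sub>R b' l\<close> or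
        \<open>e = - u + 2 *\<^sub>R b' l\<close>.\<close>
      have no: "e \<noteq> u + 2 *\<^sub>R b' l" "e \<noteq> - u + 2 *\<^sub>R b' l" for l
        using extreme_point_not_add_double[OF N P n, of u "b' l" e]
          extreme_point_not_add_double[OF N P n, of "- u" "b' l" e]
          u_b'[of l] u minus[OF u] ext_b'[of l] e(1) by (auto simp: ext_def)
      have two: "2 *\<^sub>R v = v + v" for v :: "real ^ 'n" by (simp add: scaleR_2)
      show False
        using r[of i] r[of j] r[of k] no[of i] no[of j] no[of k] *
        unfolding u3 e3 two by (elim disjE) (simp_all add: algebra_simps)
    qed
    then have "cross_polytope (unit_ball N)"
      using ext_b' e(1) coef(1) eb' unfolding ext_def
      by (intro cross_polytope_if_extreme_points[OF N, of b']) auto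
    with coef(1) show ?thesis by blast
  qed
qed

section \<open>Spaces with the diameter property\<close>

text \<open>Such a body is a segment and its midpoint is a center. This settles the case
  \<open>n = 2\<close>.\<close>

lemma diameter_eq_if_aff_dim_le_1:
  assumes N: "is_norm N" and K: "convex_body K" "aff_dim K \<le> 1"
  shows "norm_diameter N K = 2 * circumradius N K"
proof -
  have K': "K \<noteq> {}" "convex K" "compact K" using K(1) by (auto simp: convex_body_def)
  obtain a b where ab: "K = closed_segment a b"
    using compact_convex_collinear_segment[of K] K' K(2) by (auto simp: collinear_aff_dim)
  show ?thesis
  proof (rule diameter_eq_if_center[OF N K'(3,1)])
    fix x assume "x \<in> K"
    then obtain u where u: "0 \<le> u" "u \<le> 1" "x = (1 - u) *\<^sub>R a + u *\<^sub>R b"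
      unfolding ab in_segment by blast
    have "x - (1 / 2) *\<^sub>R (a + b) = (1 / 2 - u) *\<^sub>R (a - b)"
      by (simp add: u(3) vec_eq_iff algebra_simps)
    then have "N (x - (1 / 2) *\<^sub>R (a + b)) = \<bar>1 / 2 - u\<bar> * N (a - b)"
      by (simp add: is_norm_scaleR[OF N])
    also have "\<dots> \<le> 1 / 2 * N (a - b)"
      using u by (intro mult_right_mono is_norm_nonneg[OF N]) (simp only: abs_le_iff, linarith)
    also have "\<dots> \<le> norm_diameter N K / 2"
      using norm_diff_le_diameter[OF N K'(3), of a b] by (simp add: ab)
    finally show "N (x - (1 / 2) *\<^sub>R (a + b)) \<le> norm_diameter N K / 2" .
  qed
qed

text \<open>The translation part of \<open>f\<close> vanishes, because \<open>P\<close> would otherwise be invariant under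
  a nonzero translation.\<close>

lemma symmetric_affine_image_unit_ball:
  fixes N :: "real ^ 'n \<Rightarrow> real"
  assumes N: "is_norm N" and f: "nonsingular_affine_map f" "unit_ball N = f ` P"
    and P: "compact P" "P \<noteq> {}" "\<And>x. x \<in> P \<Longrightarrow> - x \<in> P"
  obtains M :: "real ^ 'n ^ 'n" where "invertible M" "\<And>x. N x \<le> 1 \<longleftrightarrow> M *v x \<in> P"
proof -
  obtain A :: "real ^ 'n ^ 'n" and b where A: "invertible A" and f_def: "f = (\<lambda>x. A *v x + b)"
    using f(1) by (auto simp: nonsingular_affine_map_def)
  obtain M where M: "A ** M = mat 1" "M ** A = mat 1" using A by (auto simp: invertible_def)
  have AM: "A *v (M *v x) = x" "M *v (A *v x) = x" for x
    using M by (simp_all add: matrix_vector_mul_assoc)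
  define u where "u = M *v b"
  have f': "f x = A *v (x + u)" for x
    by (simp add: f_def u_def matrix_vector_right_distrib AM)
  \<comment> \<open>Symmetry of the ball pairs \<open>x\<close> with some \<open>y\<close> in
    \<open>P\<close> such that \<open>- (x + u) = y + u\<close>; then
    \<open>x + 2 *\<^sub>R u = - y\<close> lies in \<open>P\<close> by symmetry of
    \<open>P\<close>.\<close>
  have shift: "x + 2 *\<^sub>R u \<in> P" if "x \<in> P" for x
  proof -
    have "f x \<in> unit_ball N" using that f(2) by simp
    then have "- f x \<in> f ` P" unfolding f(2)[symmetric] by (simp add: unit_ball_def is_norm_minus[OF N])
    then obtain y where y: "y \<in> P" "- f x = f y" by blast
    have "M *v (- f x) = M *v f y" using y by simp
    then have "- (x + u) = y + u" by (simp add: f' AM linear_neg[OF matrix_vector_mul_linear])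
    then have "x + 2 *\<^sub>R u = - y" by (simp add: algebra_simps scaleR_2 eq_neg_iff_add_eq_0)
    with P(3)[OF y(1)] show ?thesis by simp
  qed
  \<comment> \<open>A maximizer of the functional \<open>u\<close> on the compact set
    \<open>P\<close> cannot move further in direction \<open>u\<close>.\<close>
  obtain x where x: "x \<in> P" "\<And>y. y \<in> P \<Longrightarrow> u \<bullet> y \<le> u \<bullet> x"
    using continuous_attains_sup[OF P(1,2), of "\<lambda>y. u \<bullet> y"] by (force intro: continuous_intros)
  have "u \<bullet> u \<le> 0" using x(2)[OF shift[OF x(1)]] by (simp add: inner_add_right)
  then have "u = 0" by (metis inner_eq_zero_iff inner_ge_zero order_antisym)
  then have "N x \<le> 1 \<longleftrightarrow> M *v x \<in> P" for x
    using f(2) AM by (force simp: f' unit_ball_def set_eq_iff image_iff)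
  moreover have "invertible M" using M by (auto simp: invertible_def)
  ultimately show ?thesis using that by blast
qed

section \<open>Norms whose unit ball is cut out by a family of functionals\<close>

lemma norm_le_iff_functionals:
  assumes N: "is_norm N" and F: "\<And>x. N x \<le> 1 \<longleftrightarrow> (\<forall>i. \<bar>g i \<bullet> x\<bar> \<le> 1)" and "0 \<le> r"
  shows "N x \<le> r \<longleftrightarrow> (\<forall>i. \<bar>g i \<bullet> x\<bar> \<le> r)"
proof -
  have pos: "N x \<le> r \<longleftrightarrow> (\<forall>i. \<bar>g i \<bullet> x\<bar> \<le> r)" if "0 < r" for r
  proof -
    have "N x \<le> r \<longleftrightarrow> N ((1 / r) *\<^sub>R x) \<le> 1"
      using that by (simp add: is_norm_scaleR[OF N])
    also have "\<dots> \<longleftrightarrow> (\<forall>i. \<bar>g i \<bullet> x\<bar> \<le> r)"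
      unfolding F using that by (simp add: abs_mult)
    finally show ?thesis .
  qed
  show ?thesis
  proof
    assume "N x \<le> r"
    \<comment> \<open>The radius \<open>r\<close> may be 0, where rescaling to the unit ball fails;
      it is approached through the positive radii \<open>r + e\<close>.\<close>
    then have "\<bar>g i \<bullet> x\<bar> \<le> r + e" if "0 < e" for i e
      using pos[of "r + e"] that \<open>0 \<le> r\<close> by force
    then show "\<forall>i. \<bar>g i \<bullet> x\<bar> \<le> r" by (blast intro: field_le_epsilon)
  next
    assume *: "\<forall>i. \<bar>g i \<bullet> x\<bar> \<le> r"
    have "N x \<le> r + e" if "0 < e" for e
    proof (rule pos[THEN iffD2], use that \<open>0 \<le> r\<close> in simp, rule allI)
      show "\<bar>g i \<bullet> x\<bar> \<le> r + e" for i using *[rule_format, of i] that by linarith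
    qed
    then show "N x \<le> r" by (blast intro: field_le_epsilon)
  qed
qed

lemma diameter_eq_if_functional_center:
  assumes N: "is_norm N" and K: "convex_body K"
    and F: "\<And>x. N x \<le> 1 \<longleftrightarrow> (\<forall>i. \<bar>g i \<bullet> x\<bar> \<le> 1)"
    and c: "\<And>i x. x \<in> K \<Longrightarrow> \<bar>g i \<bullet> (x - c)\<bar> \<le> norm_diameter N K / 2"
  shows "norm_diameter N K = 2 * circumradius N K"
proof (rule diameter_eq_if_center[OF N])
  show K': "compact K" "K \<noteq> {}" using K by (auto simp: convex_body_def)
  obtain z where "z \<in> K" using K' by blast
  then have "0 \<le> norm_diameter N K"
    using norm_diff_le_diameter[OF N K'(1), of z z] is_norm_zero[OF N] by simp
  then show "N (x - c) \<le> norm_diameter N K / 2" if "x \<in> K" for x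
    using norm_le_iff_functionals[OF N F, of "norm_diameter N K / 2" "x - c"] c[OF that] by simp
qed

text \<open>The points \<open>p i\<close> and \<open>q i\<close> delimit the range of
  \<open>g i\<close> on \<open>K\<close>, whose length is at most the diameter because
  \<open>g i\<close> is dominated by \<open>N\<close>.\<close>

lemma functional_range:
  assumes N: "is_norm N" and K: "convex_body K"
    and F: "\<And>x. N x \<le> 1 \<longleftrightarrow> (\<forall>i. \<bar>g i \<bullet> x\<bar> \<le> 1)"
  obtains p q where "\<And>i. p i \<in> K" "\<And>i. q i \<in> K"
    "\<And>i x. x \<in> K \<Longrightarrow> g i \<bullet> q i \<le> g i \<bullet> x \<and> g i \<bullet> x \<le> g i \<bullet> p i"
    "\<And>i x y. x \<in> K \<Longrightarrow> y \<in> K \<Longrightarrow> g i \<bullet> x - g i \<bullet> y \<le> norm_diameter N K"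
proof -
  have K': "compact K" "K \<noteq> {}" using K by (auto simp: convex_body_def)
  have "\<exists>p\<in>K. \<forall>x\<in>K. g i \<bullet> x \<le> g i \<bullet> p" for i
    using continuous_attains_sup[OF K', of "\<lambda>y. g i \<bullet> y"] by (force intro: continuous_intros)
  then obtain p where p: "\<And>i. p i \<in> K" "\<And>i x. x \<in> K \<Longrightarrow> g i \<bullet> x \<le> g i \<bullet> p i" by metis
  have "\<exists>p\<in>K. \<forall>x\<in>K. g i \<bullet> p \<le> g i \<bullet> x" for i
    using continuous_attains_inf[OF K', of "\<lambda>y. g i \<bullet> y"] by (force intro: continuous_intros)
  then obtain q where q: "\<And>i. q i \<in> K" "\<And>i x. x \<in> K \<Longrightarrow> g i \<bullet> q i \<le> g i \<bullet> x" by metis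
  have "g i \<bullet> x - g i \<bullet> y \<le> norm_diameter N K" if xy: "x \<in> K" "y \<in> K" for i x y
  proof -
    have "\<bar>g i \<bullet> (x - y)\<bar> \<le> N (x - y)"
      using norm_le_iff_functionals[OF N F is_norm_nonneg[OF N], of "x - y" "x - y"] by blast
    then show ?thesis
      using norm_diff_le_diameter[OF N K'(1) xy] by (simp add: inner_diff_right abs_le_iff)
  qed
  then show ?thesis using p q by (intro that[of p q]) auto
qed

text \<open>In the coordinates given by the rows of \<open>M\<close> the norm is a maximum norm, so
  each coordinate of the center can be chosen independently, as the midpoint of its range on
  \<open>K\<close>.\<close>

lemma diameter_eq_if_parallelotope:
  fixes N :: "real ^ 'n \<Rightarrow> real"
  assumes N: "is_norm N" and B: "parallelotope (unit_ball N)" and K: "convex_body K"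
  shows "norm_diameter N K = 2 * circumradius N K"
proof -
  let ?C = "{x :: real ^ 'n. \<forall>i. - 1 \<le> x $ i \<and> x $ i \<le> 1}"
  have "?C = cbox (\<chi> i. - 1) (\<chi> i. 1)" by (auto simp: mem_box_cart)
  then have C: "compact ?C" by simp
  obtain f where "nonsingular_affine_map f" "unit_ball N = f ` ?C"
    using B by (auto simp: parallelotope_def)
  then obtain M :: "real ^ 'n ^ 'n" where inv: "invertible M" and M: "\<And>x. N x \<le> 1 \<longleftrightarrow> M *v x \<in> ?C"
    by (rule symmetric_affine_image_unit_ball[OF N _ _ C]) (auto intro!: exI[of _ 0] simp: minus_le_iff)
  obtain M' where M': "M ** M' = mat 1" using inv by (auto simp: invertible_def)
  have F: "N x \<le> 1 \<longleftrightarrow> (\<forall>i. \<bar>M $ i \<bullet> x\<bar> \<le> 1)" for x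
    by (auto simp: M matrix_vector_mul_component abs_le_iff minus_le_iff)
  obtain p q where pq: "\<And>i. p i \<in> K" "\<And>i. q i \<in> K"
    "\<And>i x. x \<in> K \<Longrightarrow> M $ i \<bullet> q i \<le> M $ i \<bullet> x \<and> M $ i \<bullet> x \<le> M $ i \<bullet> p i"
    "\<And>i x y. x \<in> K \<Longrightarrow> y \<in> K \<Longrightarrow> M $ i \<bullet> x - M $ i \<bullet> y \<le> norm_diameter N K"
    using functional_range[OF N K F] by blast
  define z where "z = (\<chi> i. (M $ i \<bullet> p i + M $ i \<bullet> q i) / 2)"
  have "M *v (M' *v z) = z" using M' by (simp add: matrix_vector_mul_assoc)
  then have c: "M $ i \<bullet> (M' *v z) = z $ i" for i by (metis matrix_vector_mul_component)
  show ?thesis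
  proof (rule diameter_eq_if_functional_center[OF N K F])
    fix i x assume "x \<in> K"
    have "z $ i = (M $ i \<bullet> p i + M $ i \<bullet> q i) / 2" by (simp add: z_def)
    then show "\<bar>M $ i \<bullet> (x - M' *v z)\<bar> \<le> norm_diameter N K / 2"
      using conjunct1[OF pq(3)[OF \<open>x \<in> K\<close>, of i]] conjunct2[OF pq(3)[OF \<open>x \<in> K\<close>, of i]]
        pq(4)[OF pq(1)[of i] pq(2)[of i], of i]
      unfolding inner_diff_right c by (intro abs_leI) (simp_all add: field_simps)
  qed
qed

section \<open>Affine dependences and a trace inequality for four points\<close>

lemma affine_dependent_family:
  fixes p :: "'a::finite \<Rightarrow> 'b::euclidean_space"
  assumes "aff_dim (range p) < int CARD('a) - 1"
  obtains w where "\<exists>i. w i \<noteq> 0" "(\<Sum>i\<in>UNIV. w i) = 0" "(\<Sum>i\<in>UNIV. w i *\<^sub>R p i) = 0"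
proof (cases "inj p")
  case True
  then have "affine_dependent (range p)"
    using assms affine_independent_iff_card[of "range p"] card_image[OF True] by auto
  then obtain U where "sum U (range p) = 0" "\<exists>v\<in>range p. U v \<noteq> 0" "(\<Sum>v\<in>range p. U v *\<^sub>R v) = 0"
    by (auto simp: affine_dependent_explicit_finite)
  with True that[of "U \<circ> p"] show ?thesis by (simp add: sum.reindex)
next
  case False
  then obtain i j where ij: "i \<noteq> j" "p i = p j" by (auto simp: inj_def)
  \<comment> \<open>Two coinciding points give the relation \<open>p i - p j = 0\<close>.\<close>
  define w where "w k = (if k = i then 1 else 0) - (if k = j then 1 else 0 :: real)" for k
  have "(\<Sum>k\<in>UNIV. w k *\<^sub>R p k) = (\<Sum>k\<in>UNIV. (if k = i then p k else 0) - (if k = j then p k else 0))"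
    by (intro sum.cong) (auto simp: w_def)
  also have "\<dots> = 0" using ij by (simp add: sum_subtractf)
  finally show ?thesis
    using ij by (intro that[of w]) (auto simp: w_def sum_subtractf intro: exI[of _ i])
qed

text \<open>Radon partitions of four coplanar points: in a \<open>1 + 3\<close> partition \<open>G d d\<close> is an average of the
  \<open>G d j\<close>, in a \<open>2 + 2\<close> partition everything is compared with the crossing point.\<close>

lemma trace_le_if_one_three:
  fixes G :: "'a::finite \<Rightarrow> 'a \<Rightarrow> real"
  assumes card: "CARD('a) = 4" and col: "\<And>j. (\<Sum>i\<in>UNIV. G i j) = 0"
    and diff: "\<And>i j k. G i j - G i k \<le> \<delta>"
    and w: "\<exists>i. w i \<noteq> 0" "(\<Sum>i\<in>UNIV. w i) = 0" "\<And>i. (\<Sum>j\<in>UNIV. w j * G i j) = 0"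
    and nonneg: "\<And>i. i \<noteq> d \<Longrightarrow> 0 \<le> w i"
  shows "(\<Sum>i\<in>UNIV. G i i) \<le> 2 * \<delta>"
proof -
  define T where "T = (\<Sum>i\<in>UNIV. G i i)"
  have split: "(\<Sum>i\<in>UNIV. F i) = F d + (\<Sum>i\<in>-{d}. F i)" for F :: "'a \<Rightarrow> real"
    by (subst sum.remove[of _ d]) (auto simp: Compl_eq_Diff_UNIV)
  have W: "- w d = (\<Sum>j\<in>-{d}. w j)" using w(2) by (simp add: split)
  have "w d < 0"
  proof (rule ccontr)
    assume "\<not> w d < 0"
    moreover have "0 \<le> (\<Sum>j\<in>-{d}. w j)" using nonneg by (intro sum_nonneg) auto
    ultimately have "w d = 0" "(\<Sum>j\<in>-{d}. w j) = 0" using W by auto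
    then have "\<forall>j\<in>-{d}. w j = 0" using nonneg by (subst (asm) sum_nonneg_eq_0_iff) auto
    with \<open>w d = 0\<close> w(1) show False by auto
  qed
  \<comment> \<open>Since column \<open>j\<close> sums to zero, the left side is a sum of
    differences \<open>G i i - G i j\<close>; the one at \<open>i = j\<close> vanishes, so only two
    remain.\<close>
  have B: "T - G d d + G d j \<le> 2 * \<delta>" if "j \<noteq> d" for j
  proof -
    have "T - G d d + G d j = (\<Sum>i\<in>-{d}. G i i - G i j)"
      using col[of j] by (simp add: T_def split[of "\<lambda>i. G i i"] split[of "\<lambda>i. G i j"] sum_subtractf)
    also have "\<dots> = (\<Sum>i\<in>-{d, j}. G i i - G i j)"
      by (intro sum.mono_neutral_right) auto
    also have "\<dots> \<le> of_nat (card (-{d, j})) * \<delta>"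
      by (intro sum_bounded_above diff)
    also have "card (-{d, j}) = 2"
      using that card by (simp add: Compl_eq_Diff_UNIV card_Diff_subset)
    finally show ?thesis by simp
  qed
  have "- w d * G d d = (\<Sum>j\<in>-{d}. w j * G d j)" using w(3)[of d] by (simp add: split)
  then have "- w d * T = (\<Sum>j\<in>-{d}. w j * (T - G d d)) + (\<Sum>j\<in>-{d}. w j * G d j)"
    unfolding sum_distrib_right[symmetric] W[symmetric] by (simp add: algebra_simps)
  also have "\<dots> = (\<Sum>j\<in>-{d}. w j * (T - G d d + G d j))"
    by (simp add: sum.distrib distrib_left)
  also have "\<dots> \<le> (\<Sum>j\<in>-{d}. w j * (2 * \<delta>))"
    using B nonneg by (intro sum_mono mult_left_mono) auto
  also have "\<dots> = - w d * (2 * \<delta>)" by (simp only: W sum_distrib_right)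
  finally show ?thesis using \<open>w d < 0\<close> by (simp add: T_def)
qed

lemma trace_le_if_two_two:
  fixes G :: "'a::finite \<Rightarrow> 'a \<Rightarrow> real"
  assumes abcd: "UNIV = {a, b, c, d}" "distinct [a, b, c, d]" and col: "\<And>j. (\<Sum>i\<in>UNIV. G i j) = 0"
    and diff: "\<And>i j k. G i j - G i k \<le> \<delta>"
    and w: "(\<Sum>i\<in>UNIV. w i) = 0" "\<And>i. (\<Sum>j\<in>UNIV. w j * G i j) = 0"
    and sign: "0 < w a" "0 < w b" "w c < 0" "w d < 0"
  shows "(\<Sum>i\<in>UNIV. G i i) \<le> 2 * \<delta>"
proof -
  have sum: "(\<Sum>i\<in>UNIV. F i) = F a + F b + F c + F d" for F :: "'a \<Rightarrow> real"
    unfolding abcd(1) using abcd(2) by simp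
  define W where "W = w a + w b"
  have W: "W = - w c - w d" "0 < W" using w(1) sign by (simp_all add: W_def sum)
  \<comment> \<open>With \<open>G i j\<close> read as functional \<open>i\<close> at point
    \<open>j\<close>, \<open>Q i\<close> is \<open>W\<close> times the value at the crossing point
    of the segments \<open>a b\<close> and \<open>c d\<close>.\<close>
  define Q where "Q i = w a * G i a + w b * G i b" for i
  have Q: "Q i = - w c * G i c - w d * G i d" for i using w(2)[of i] by (simp add: Q_def sum)
  have "Q a + Q b + Q c + Q d =
      w a * (\<Sum>i\<in>UNIV. G i a) + w b * (\<Sum>i\<in>UNIV. G i b)"
    unfolding sum by (simp add: Q_def algebra_simps)
  then have Q0: "Q a + Q b + Q c + Q d = 0" by (simp add: col)
  have 1: "W * G a a - Q a = w b * (G a a - G a b)" "W * G b b - Q b = w a * (G b b - G b a)"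
    by (simp_all add: W_def Q_def algebra_simps)
  have 2: "W * G c c - Q c = - w d * (G c c - G c d)" "W * G d d - Q d = - w c * (G d d - G d c)"
    by (simp_all add: W(1) Q algebra_simps)
  have "W * (\<Sum>i\<in>UNIV. G i i) =
      (W * G a a - Q a) + (W * G b b - Q b) + (W * G c c - Q c) + (W * G d d - Q d)"
    using Q0 by (simp add: sum algebra_simps)
  also have "\<dots> \<le> w b * \<delta> + w a * \<delta> + (- w d) * \<delta> + (- w c) * \<delta>"
    unfolding 1 2 using sign diff by (intro add_mono mult_left_mono) auto
  also have "\<dots> = (w a + w b) * \<delta> + (- w c - w d) * \<delta>" by (simp add: algebra_simps)
  also have "\<dots> = W * (2 * \<delta>)" by (simp flip: W(1) W_def)
  finally show ?thesis using W(2) by simp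
qed

text \<open>Among the four weights at most one is negative, or at most one is positive, or there are
  two of each sign. Negating \<open>w\<close> reduces the second case to the first.\<close>

lemma trace_le_if_affine_dependent:
  fixes G :: "'a::finite \<Rightarrow> 'a \<Rightarrow> real"
  assumes card: "CARD('a) = 4" and col: "\<And>j. (\<Sum>i\<in>UNIV. G i j) = 0"
    and diff: "\<And>i j k. G i j - G i k \<le> \<delta>"
    and w: "\<exists>i. w i \<noteq> 0" "(\<Sum>i\<in>UNIV. w i) = 0" "\<And>i. (\<Sum>j\<in>UNIV. w j * G i j) = 0"
  shows "(\<Sum>i\<in>UNIV. G i i) \<le> 2 * \<delta>"
proof -
  consider (pos) d where "\<And>i. i \<noteq> d \<Longrightarrow> 0 \<le> w i" | (neg) d where "\<And>i. i \<noteq> d \<Longrightarrow> 0 \<le> - w i"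
    | (mixed) "\<And>d. \<exists>i. i \<noteq> d \<and> w i < 0" "\<And>d. \<exists>i. i \<noteq> d \<and> 0 < w i"
    by (metis neg_0_le_iff_le not_le)
  then show ?thesis
  proof cases
    case pos
    show ?thesis by (rule trace_le_if_one_three[OF card col diff w pos])
  next
    case neg
    show ?thesis
    proof (rule trace_le_if_one_three[OF card col diff, where w = "\<lambda>i. - w i"])
      show "0 \<le> - w i" if "i \<noteq> d" for i using neg[OF that] .
    qed (use w in \<open>auto simp: sum_negf\<close>)
  next
    case mixed
    obtain c d where cd: "w c < 0" "d \<noteq> c" "w d < 0" using mixed(1) by metis
    obtain a b where ab: "0 < w a" "b \<noteq> a" "0 < w b" using mixed(2) by metis
    have dist: "distinct [a, b, c, d]" using ab cd by auto
    then have "card {a, b, c, d} = CARD('a)" using card by simp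
    then have "UNIV = {a, b, c, d}" by (metis card_subset_eq finite subset_UNIV)
    then show ?thesis
      by (rule trace_le_if_two_two[OF _ dist col diff w(2,3)]) (use ab cd in auto)
  qed
qed

text \<open>On the segment from \<open>l\<close> to \<open>u\<close> the sum passes from a
  nonpositive to a nonnegative value.\<close>

lemma zero_sum_in_intervals:
  fixes l u :: "'a \<Rightarrow> real"
  assumes "\<And>i. i \<in> A \<Longrightarrow> l i \<le> u i" "sum l A \<le> 0" "0 \<le> sum u A"
  obtains t where "sum t A = 0" "\<And>i. i \<in> A \<Longrightarrow> l i \<le> t i \<and> t i \<le> u i"
proof -
  \<comment> \<open>If both sums agree, they are 0 and the choice \<open>t = l\<close>
    works.\<close>
  define s where "s = (if sum l A = sum u A then 0 else - sum l A / (sum u A - sum l A))"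
  have s: "0 \<le> s" "s \<le> 1" "sum l A + s * (sum u A - sum l A) = 0"
    using assms by (auto simp: s_def field_simps)
  define t where "t i = l i + s * (u i - l i)" for i
  have "sum t A = 0"
    using s(3) by (simp add: t_def sum.distrib sum_subtractf sum_distrib_left[symmetric])
  moreover have "l i \<le> t i \<and> t i \<le> u i" if "i \<in> A" for i
    using s assms(1)[OF that] mult_left_le_one_le[of "u i - l i" s] by (simp add: t_def)
  ultimately show ?thesis using that by blast
qed

text \<open>A center is found through its values \<open>t k\<close> on the four facet functionals.
  Distance at most D/2 confines each \<open>t k\<close> to an interval, and the trace inequality,
  applied to the maximizers \<open>p\<close> and, with reversed functionals, to the minimizers
  \<open>q\<close>, lets these intervals admit a zero sum. Zero-sum values are attained at a
  point.\<close>

lemma diameter_eq_if_cross_polytope: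
  fixes N :: "real ^ 'n \<Rightarrow> real"
  assumes N: "is_norm N" and n: "CARD('n) = 3" and B: "cross_polytope (unit_ball N)"
    and K: "convex_body K" and dim: "aff_dim K \<le> 2"
  shows "norm_diameter N K = 2 * circumradius N K"
proof -
  let ?C = "{x :: real ^ 'n. (\<Sum>i\<in>UNIV. \<bar>x $ i\<bar>) \<le> 1}"
  have C: "compact ?C" using compact_unit_ball[OF is_norm_l1] by (simp add: unit_ball_def)
  obtain f where "nonsingular_affine_map f" "unit_ball N = f ` ?C"
    using B by (auto simp: cross_polytope_def convex_hull_axes)
  then obtain M :: "real ^ 'n ^ 'n" where inv: "invertible M" and M: "\<And>x. N x \<le> 1 \<longleftrightarrow> M *v x \<in> ?C"
    by (rule symmetric_affine_image_unit_ball[OF N _ _ C]) (auto intro!: exI[of _ 0])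
  obtain M' where M': "M ** M' = mat 1" using inv by (auto simp: invertible_def)
  define S where "S = (\<Sum>i\<in>UNIV. M $ i)"
  \<comment> \<open>The coordinate sum is taken with a minus sign so that the four functionals sum
    to zero: -S + (3S - 2S) = 0.\<close>
  define g where "g k = (case k of None \<Rightarrow> - S | Some i \<Rightarrow> S - 2 *\<^sub>R M $ i)" for k
  have all: "(\<forall>k. Q k) \<longleftrightarrow> Q None \<and> (\<forall>i. Q (Some i))" for Q :: "'n option \<Rightarrow> bool"
    by (metis option.exhaust)
  have sum: "(\<Sum>k\<in>UNIV. h k) = h None + (\<Sum>i\<in>UNIV. h (Some i))"
    for h :: "'n option \<Rightarrow> real"
    by (simp add: UNIV_option_conv sum.reindex)
  have F: "N x \<le> 1 \<longleftrightarrow> (\<forall>k. \<bar>g k \<bullet> x\<bar> \<le> 1)" for x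
    unfolding M mem_Collect_eq l1_ball_three[OF n refl] all
    by (simp add: g_def S_def matrix_vector_mul_component inner_diff_left inner_sum_left)
  have g0: "(\<Sum>k\<in>UNIV. g k \<bullet> x) = 0" for x
    unfolding sum
    by (simp add: g_def inner_diff_left sum_subtractf sum_distrib_left[symmetric] n)
      (simp add: S_def inner_sum_left)
  have card4: "CARD('n option) = 4" using n by simp
  obtain p q where pq: "\<And>k. p k \<in> K" "\<And>k. q k \<in> K"
    "\<And>k x. x \<in> K \<Longrightarrow> g k \<bullet> q k \<le> g k \<bullet> x \<and> g k \<bullet> x \<le> g k \<bullet> p k"
    "\<And>k x y. x \<in> K \<Longrightarrow> y \<in> K \<Longrightarrow> g k \<bullet> x - g k \<bullet> y \<le> norm_diameter N K"
    using functional_range[OF N K F] by blast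
  define r where "r = norm_diameter N K / 2"
  \<comment> \<open>The matrix with entries \<open>h i \<bullet> y j\<close> has zero column sums,
    and four points of a set of dimension at most 2 are affinely dependent.\<close>
  have bound: "(\<Sum>k\<in>UNIV. h k \<bullet> y k) \<le> 2 * norm_diameter N K"
    if y: "\<And>k. y k \<in> K" and h: "\<And>x. (\<Sum>k\<in>UNIV. h k \<bullet> x) = 0"
      "\<And>k x y. x \<in> K \<Longrightarrow> y \<in> K \<Longrightarrow> h k \<bullet> x - h k \<bullet> y \<le> norm_diameter N K"
    for h y :: "'n option \<Rightarrow> real ^ 'n"
  proof -
    have "aff_dim (range y) \<le> aff_dim K" using y by (intro aff_dim_subset) auto
    then have "aff_dim (range y) < int CARD('n option) - 1" using dim card4 by simp
    then obtain w where w: "\<exists>i. w i \<noteq> 0" "(\<Sum>i\<in>UNIV. w i) = 0" "(\<Sum>i\<in>UNIV. w i *\<^sub>R y i) = 0"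
      by (rule affine_dependent_family)
    have "(\<Sum>j\<in>UNIV. w j * (h i \<bullet> y j)) = h i \<bullet> (\<Sum>j\<in>UNIV. w j *\<^sub>R y j)" for i
      by (simp add: inner_sum_right)
    then show ?thesis
      using w y h by (intro trace_le_if_affine_dependent[OF card4, where w = w]) simp_all
  qed
  have "(\<Sum>k\<in>UNIV. g k \<bullet> p k) \<le> 2 * norm_diameter N K"
    by (rule bound[OF pq(1) g0 pq(4)])
  \<comment> \<open>Four copies of \<open>r\<close> make up twice the diameter.\<close>
  then have lower: "(\<Sum>k\<in>UNIV. g k \<bullet> p k - r) \<le> 0"
    using card4 by (simp add: sum_subtractf r_def)
  have "(\<Sum>k\<in>UNIV. (- g k) \<bullet> q k) \<le> 2 * norm_diameter N K"
    using pq(2) g0 pq(4) by (intro bound) (auto simp: sum_negf)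
  then have upper: "0 \<le> (\<Sum>k\<in>UNIV. g k \<bullet> q k + r)"
    using card4 by (simp add: sum.distrib sum_negf r_def)
  have "g k \<bullet> p k - r \<le> g k \<bullet> q k + r" for k
    using pq(4)[OF pq(1)[of k] pq(2)[of k], of k] by (simp add: r_def)
  then obtain t where t: "sum t UNIV = 0"
    "\<And>k. g k \<bullet> p k - r \<le> t k \<and> t k \<le> g k \<bullet> q k + r"
    using zero_sum_in_intervals[OF _ lower upper] by auto
  define s where "s = (\<Sum>i\<in>UNIV. t (Some i))"
  \<comment> \<open>Solves \<open>s - 2 * z $ i = t (Some i)\<close>; the coordinates of
    \<open>z\<close> then add up to \<open>s\<close>, which is \<open>- t None\<close>, as the
    functional \<open>- S\<close> demands.\<close>
  define z :: "real ^ 'n" where "z = (\<chi> i. (s - t (Some i)) / 2)"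
  have "M *v (M' *v z) = z" using M' by (simp add: matrix_vector_mul_assoc)
  then have c: "M $ i \<bullet> (M' *v z) = z $ i" for i by (metis matrix_vector_mul_component)
  have "S \<bullet> (M' *v z) = (\<Sum>i\<in>UNIV. z $ i)" by (simp add: S_def inner_sum_left c)
  also have "\<dots> = (3 * s - s) / 2"
    by (simp add: z_def sum_divide_distrib[symmetric] sum_subtractf n s_def)
  finally have Sc: "S \<bullet> (M' *v z) = s" by simp
  have gc: "g k \<bullet> (M' *v z) = t k" for k
  proof (cases k)
    case None
    then show ?thesis using t(1) by (simp add: g_def Sc sum s_def)
  next
    case (Some i)
    have "z $ i = (s - t (Some i)) / 2" by (simp add: z_def)
    with Some show ?thesis by (simp add: g_def inner_diff_left Sc c)
  qed
  show ?thesis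
  proof (rule diameter_eq_if_functional_center[OF N K F])
    fix k x assume "x \<in> K"
    show "\<bar>g k \<bullet> (x - M' *v z)\<bar> \<le> norm_diameter N K / 2"
      using conjunct1[OF pq(3)[OF \<open>x \<in> K\<close>, of k]] conjunct2[OF pq(3)[OF \<open>x \<in> K\<close>, of k]]
        conjunct1[OF t(2)[of k]] conjunct2[OF t(2)[of k]]
      unfolding inner_diff_right gc r_def by (intro abs_leI) linarith+
  qed
qed

theorem theorem1p1:
  fixes N :: "real ^ 'n \<Rightarrow> real"
  assumes "CARD('n) \<ge> 2"
    and "is_norm N"
  shows "(\<forall>K :: (real ^ 'n) set. convex_body K \<and> aff_dim K \<le> int CARD('n) - 1 \<longrightarrow>
            norm_diameter N K = 2 * circumradius N K) \<longleftrightarrow>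
         (CARD('n) = 2 \<or> parallelotope (unit_ball N)) \<or>
         (CARD('n) = 3 \<and> cross_polytope (unit_ball N))"
  unfolding lowdim_diameter_property_def[symmetric]
proof
  assume "lowdim_diameter_property N"
  then show "(CARD('n) = 2 \<or> parallelotope (unit_ball N)) \<or> CARD('n) = 3 \<and> cross_polytope (unit_ball N)"
    using lowdim_diameter_property_imp_shape[OF assms(2)] assms(1) by linarith
next
  assume "(CARD('n) = 2 \<or> parallelotope (unit_ball N)) \<or> CARD('n) = 3 \<and> cross_polytope (unit_ball N)"
  then show "lowdim_diameter_property N"
    unfolding lowdim_diameter_property_def
    using diameter_eq_if_aff_dim_le_1[OF assms(2)] diameter_eq_if_parallelotope[OF assms(2)]
      diameter_eq_if_cross_polytope[OF assms(2)] by auto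
qed

end
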